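(* Let $a,b:(x_0,y_0)\to\mathbb{R}$ be continuous with $a>0$, fix $c_0\in(x_0,y_0)$, and put $$s'(x)=\exp\Big(-\int_{c_0}^x\frac{b(z)}{a(z)}dz\Big),\qquad m'(x)=\frac1{a(x)}\exp\Big(\int_{c_0}^x\frac{b(z)}{a(z)}dz\Big).$$ Assume that $Z:=\int_{x_0}^{y_0}m'(x)\,dx<+\infty$ and $$\int_{c_0}^{y_0}s'(x)\Big(\int_{c_0}^xm'(z)\,dz\Big)dx=\int_{x_0}^{c_0}s'(x)\Big(\int_x^{c_0}m'(z)\,dz\Big)dx=+\infty,$$ and let $\mu(dx)=m'(x)\,dx/Z$. Let $\rho\in C^1(x_0,y_0)$ with $\rho\in L^2(\mu)$ and $\rho'>0$ everywhere, and let $d_\rho(x,y)=|\rho(x)-\rho(y)|$. Assume $$C(\rho):=\sup_{x\in(x_0,y_0)}\frac{s'(x)}{\rho'(x)}\int_x^{y_0}[\rho(z)-\mu(\rho)]\,m'(z)\,dz<+\infty$$ and $\sigma:=\sup_{x\in(x_0,y_0)}\sqrt{a(x)}\,\rho'(x)<+\infty$. Then $\mu$ satisfies $W_1I(\sigma C(\rho))$ on $((x_0,y_0),d_\rho)$, i.e. $$W_{1,d_\rho}(\nu,\mu)^2\le4(\sigma C(\rho))^2\,I(\nu|\mu),\qquad\forall\nu\in M_1((x_0,y_0)).$$ In particular, for $\rho_a(x)=\int_{c_0}^x\frac{dz}{\sqrt{a(z)}}$, if $\rho_a\in L^2(\mu)$ and $C(\rho_a)<+\infty$, then $\mu$ satisfies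 $W_1I(c)$ on $((x_0,y_0),d_{\rho_a})$ with $c=C(\rho_a)$, i.e. $W_{1,d_{\rho_a}}(\nu,\mu)^2\le4C(\rho_a)^2I(\nu|\mu)$ for all $\nu$.
   Context: $(x_0,y_0)$ is an open interval (possibly unbounded) and $\mu(\rho)=\int\rho\,d\mu$. The underlying process is the one-dimensional diffusion on $(x_0,y_0)$ with generator $\mathcal{L}h=ah''+bh'$, $h\in C_0^\infty(x_0,y_0)$, which is symmetric on $L^2(\mu)$ and, under the stated conditions, non-explosive; its Dirichlet form is $\mathcal{E}(h,h)=\int_{x_0}^{y_0}a\,(h')^2\,d\mu$ with domain $\mathbb{D}(\mathcal{E})$ the absolutely continuous functions $h\in L^2(\mu)$ on $(x_0,y_0)$ with $\int a(h')^2d\mu<+\infty$. $I(\nu|\mu)=\mathcal{E}(\sqrt f,\sqrt f)$ if $\nu=f\mu$ with $\sqrt f\in\mathbb{D}(\mathcal{E})$, and $+\infty$ otherwise. $W_{1,d_\rho}$ is the $L^1$-Wasserstein distance for the metric $d_\rho$; $M_1$ denotes the set of Borel probability measures. *)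

theory Defs
  imports "HOL-Probability.Probability"
begin

section \<open>Couplings and the L1-Wasserstein distance\<close>

definition couplings :: "'a measure \<Rightarrow> 'b measure \<Rightarrow> ('a \<times> 'b) measure set" where
  "couplings M N =
     {P. sets P = sets (M \<Otimes>\<^sub>M N) \<and> distr P M fst = M \<and> distr P N snd = N}"

definition wasserstein1 :: "('a \<Rightarrow> 'a \<Rightarrow> real) \<Rightarrow> 'a measure \<Rightarrow> 'a measure \<Rightarrow> ennreal" where
  "wasserstein1 d M N = (INF P\<in>couplings M N. \<integral>\<^sup>+ p. ennreal (d (fst p) (snd p)) \<partial>P)"


section \<open>Dirichlet form and Fisher-Donsker-Varadhan information\<close>

definition abs_cont_on :: "real set \<Rightarrow> (real \<Rightarrow> real) \<Rightarrow> bool" where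
  "abs_cont_on S h \<longleftrightarrow>
     (\<forall>\<epsilon>>0. \<exists>\<delta>>0. \<forall>D :: (real \<times> real) set.
        finite D \<and> (\<forall>(u, v)\<in>D. u \<le> v \<and> {u..v} \<subseteq> S) \<and>
        pairwise (\<lambda>(u, v) (u', v'). {u<..<v} \<inter> {u'<..<v'} = {}) D \<and>
        (\<Sum>(u, v)\<in>D. v - u) < \<delta>
        \<longrightarrow> (\<Sum>(u, v)\<in>D. \<bar>h v - h u\<bar>) < \<epsilon>)"

text \<open>Absolute continuity on an open interval is meant on its compact subintervals: the classical
  (closed) Dirichlet form has unbounded, not uniformly continuous functions in its domain.\<close>

definition locally_abs_cont_on :: "real set \<Rightarrow> (real \<Rightarrow> real) \<Rightarrow> bool" where
  "locally_abs_cont_on S h \<longleftrightarrow> (\<forall>p q. {p..q} \<subseteq> S \<longrightarrow> abs_cont_on {p..q} h)"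

definition square_integrable :: "'a measure \<Rightarrow> ('a \<Rightarrow> real) \<Rightarrow> bool" where
  "square_integrable M h \<longleftrightarrow> h \<in> borel_measurable M \<and> integrable M (\<lambda>x. (h x)\<^sup>2)"

text \<open>The state space is \<open>space \<mu>\<close>. A locally absolutely continuous function is differentiable
  almost everywhere, so the value of \<^const>\<open>deriv\<close> elsewhere is irrelevant.\<close>

definition dirichlet_form :: "(real \<Rightarrow> real) \<Rightarrow> real measure \<Rightarrow> (real \<Rightarrow> real) \<Rightarrow> ennreal" where
  "dirichlet_form a \<mu> h = (\<integral>\<^sup>+ x. ennreal (a x * (deriv h x)\<^sup>2) \<partial>\<mu>)"

definition dirichlet_domain :: "(real \<Rightarrow> real) \<Rightarrow> real measure \<Rightarrow> (real \<Rightarrow> real) set" where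
  "dirichlet_domain a \<mu> =
     {h. locally_abs_cont_on (space \<mu>) h \<and> square_integrable \<mu> h \<and> dirichlet_form a \<mu> h < \<infinity>}"

text \<open>\<open>f\<close> is a version of the density of \<open>\<nu>\<close> whose square root lies in the form domain.\<close>

definition sqrt_density_in_domain ::
  "(real \<Rightarrow> real) \<Rightarrow> real measure \<Rightarrow> real measure \<Rightarrow> (real \<Rightarrow> real) \<Rightarrow> bool" where
  "sqrt_density_in_domain a \<mu> \<nu> f \<longleftrightarrow>
     f \<in> borel_measurable \<mu> \<and> (\<forall>x\<in>space \<mu>. 0 \<le> f x) \<and> \<nu> = density \<mu> (\<lambda>x. ennreal (f x)) \<and>
     (\<lambda>x. sqrt (f x)) \<in> dirichlet_domain a \<mu>"

text \<open>The choice is immaterial for the measures considered here: \<open>\<mu>\<close> has full support, and two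
  continuous versions of a density that agree \<open>\<mu>\<close>-almost everywhere then agree everywhere.\<close>

definition fisher_information :: "(real \<Rightarrow> real) \<Rightarrow> real measure \<Rightarrow> real measure \<Rightarrow> ennreal" where
  "fisher_information a \<nu> \<mu> =
     (if \<exists>f. sqrt_density_in_domain a \<mu> \<nu> f
      then dirichlet_form a \<mu> (\<lambda>x. sqrt ((SOME f. sqrt_density_in_domain a \<mu> \<nu> f) x))
      else \<infinity>)"

definition W1I :: "(real \<Rightarrow> real) \<Rightarrow> real measure \<Rightarrow> (real \<Rightarrow> real \<Rightarrow> real) \<Rightarrow> real \<Rightarrow> bool" where
  "W1I a \<mu> d c \<longleftrightarrow>
     (\<forall>\<nu>. prob_space \<nu> \<and> sets \<nu> = sets (restrict_space borel (space \<mu>))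
        \<longrightarrow> (wasserstein1 d \<nu> \<mu>)\<^sup>2 \<le> ennreal (4 * c\<^sup>2) * fisher_information a \<nu> \<mu>)"


section \<open>The one-dimensional diffusion\<close>

text \<open>\<open>LBINT z=u..v\<close> is the oriented integral, so \<open>x < c0\<close> is covered.\<close>

definition scale_deriv :: "(real \<Rightarrow> real) \<Rightarrow> (real \<Rightarrow> real) \<Rightarrow> real \<Rightarrow> real \<Rightarrow> real" where
  "scale_deriv a b c0 x = exp (- (LBINT z=ereal c0..ereal x. b z / a z))"

definition speed_deriv :: "(real \<Rightarrow> real) \<Rightarrow> (real \<Rightarrow> real) \<Rightarrow> real \<Rightarrow> real \<Rightarrow> real" where
  "speed_deriv a b c0 x = 1 / a x * exp (LBINT z=ereal c0..ereal x. b z / a z)"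

definition speed_mass ::
  "(real \<Rightarrow> real) \<Rightarrow> (real \<Rightarrow> real) \<Rightarrow> real \<Rightarrow> ereal \<Rightarrow> ereal \<Rightarrow> ennreal" where
  "speed_mass a b c0 x0 y0 =
     (\<integral>\<^sup>+ x\<in>einterval x0 y0. ennreal (speed_deriv a b c0 x) \<partial>lborel)"

definition invariant_measure ::
  "(real \<Rightarrow> real) \<Rightarrow> (real \<Rightarrow> real) \<Rightarrow> real \<Rightarrow> ereal \<Rightarrow> ereal \<Rightarrow> real measure" where
  "invariant_measure a b c0 x0 y0 =
     density (restrict_space lborel (einterval x0 y0))
       (\<lambda>x. ennreal (speed_deriv a b c0 x) / speed_mass a b c0 x0 y0)"

definition metric_of :: "(real \<Rightarrow> real) \<Rightarrow> real \<Rightarrow> real \<Rightarrow> real" where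
  "metric_of \<rho> x y = \<bar>\<rho> x - \<rho> y\<bar>"

definition C_const ::
  "(real \<Rightarrow> real) \<Rightarrow> (real \<Rightarrow> real) \<Rightarrow> real \<Rightarrow> ereal \<Rightarrow> ereal \<Rightarrow> (real \<Rightarrow> real) \<Rightarrow> ereal" where
  "C_const a b c0 x0 y0 \<rho> =
     (SUP x\<in>einterval x0 y0. ereal (scale_deriv a b c0 x / deriv \<rho> x *
        (LBINT z=ereal x..y0.
           (\<rho> z - (LINT w|invariant_measure a b c0 x0 y0. \<rho> w)) * speed_deriv a b c0 z)))"

definition sigma_const :: "(real \<Rightarrow> real) \<Rightarrow> ereal \<Rightarrow> ereal \<Rightarrow> (real \<Rightarrow> real) \<Rightarrow> ereal" where
  "sigma_const a x0 y0 \<rho> = (SUP x\<in>einterval x0 y0. ereal (sqrt (a x) * deriv \<rho> x))"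

definition rho_a :: "(real \<Rightarrow> real) \<Rightarrow> real \<Rightarrow> real \<Rightarrow> real" where
  "rho_a a c0 x = (LBINT z=ereal c0..ereal x. 1 / sqrt (a z))"

end

(* With D = F_nu - F_mu the difference of the distribution functions, the quantile coupling gives
   W(nu, mu) <= int rho' |D|. If nu = h^2 mu, then D(x) is the integral of h(y)^2 - h(z)^2 over
   y <= x < z with respect to mu x mu, and |h(z)^2 - h(y)^2| <= int_y^z 2 |h h'| because h is
   locally absolutely continuous. By Fubini, W(nu, mu) <= int 2 |h h'| K with
   K(t) = int int_{y <= t <= z} (rho(z) - rho(y)) dmu dmu = int_{z > t} (rho - mu(rho)) dmu,
   and K dt <= C(rho) rho' a dmu by the definition of C(rho) and s' m' a = 1. The Cauchy-Schwarz
   inequality finishes the proof. *)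
theory Submission
  imports Defs
begin

section \<open>Absolute continuity and total variation\<close>

text \<open>The analytic obstacle is h: the form domain supplies it only through an epsilon-delta
  condition on compact subintervals, so the bound of increments by an a.e. derivative has to be
  earned. Total variation splits a function of this kind into two monotone ones, their Stieltjes
  measures have Lebesgue densities, and Lebesgue differentiation identifies the densities with
  derivatives. The transport part works with pairs y <= t <= z instead of integrating by parts, so
  no boundary terms at the ends of the interval arise, and all integrands in the exchanges of
  integrals are nonnegative, so Tonelli needs no integrability checks. K(t) is the covariance under
  mu of rho with the indicator of z > t, which is why C(rho) controls it. The factor 4 is the square
  of the 2 in (h^2)' = 2 h h'. Of a = sqrt a * sqrt a, one factor is absorbed with rho' into sigma
  and the other goes with h' into the Dirichlet form; the other Cauchy-Schwarz factor is the total
  mass of nu. Positivity of C(rho) needs an argument of its own: it keeps the right-hand side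
  infinite when the information is.\<close>

text \<open>The inequality u < v is strict, unlike in \<open>abs_cont_on\<close>. Each member then
  has a nonempty open interior, so members with overlapping interiors coincide and pieces of
  different members are never the same pair.\<close>

definition interval_family :: "real set \<Rightarrow> (real \<times> real) set \<Rightarrow> bool" where
  "interval_family S D \<longleftrightarrow> finite D \<and> (\<forall>(u, v)\<in>D. u < v \<and> {u..v} \<subseteq> S) \<and>
     pairwise (\<lambda>(u, v) (u', v'). {u<..<v} \<inter> {u'<..<v'} = {}) D"

definition variation_sum :: "(real \<Rightarrow> real) \<Rightarrow> (real \<times> real) set \<Rightarrow> real" where
  "variation_sum h D = (\<Sum>(u, v)\<in>D. \<bar>h v - h u\<bar>)"

text \<open>The supremum is taken in the reals, so it dominates the sums only together with
  \<open>has_bounded_variation\<close>. The empty family keeps the set of sums nonempty.\<close>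

definition total_variation :: "(real \<Rightarrow> real) \<Rightarrow> real set \<Rightarrow> real" where
  "total_variation h S = (SUP D\<in>Collect (interval_family S). variation_sum h D)"

definition has_bounded_variation :: "(real \<Rightarrow> real) \<Rightarrow> real set \<Rightarrow> bool" where
  "has_bounded_variation h S \<longleftrightarrow> bdd_above (variation_sum h ` Collect (interval_family S))"

lemma interval_family_empty [simp]: "interval_family S {}"
  by (simp add: interval_family_def)

lemma interval_family_degenerate: "y \<le> x \<Longrightarrow> interval_family {x..y} D \<Longrightarrow> D = {}"
  by (rule ccontr) (force simp: interval_family_def)

lemma interval_family_mono: "interval_family S D \<Longrightarrow> S \<subseteq> T \<Longrightarrow> interval_family T D"
  by (fastforce simp: interval_family_def)

lemma interval_family_single: "u < v \<Longrightarrow> {u..v} \<subseteq> S \<Longrightarrow> interval_family S {(u, v)}"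
  by (simp add: interval_family_def)

lemma has_bounded_variation_mono:
  "has_bounded_variation h S \<Longrightarrow> T \<subseteq> S \<Longrightarrow> has_bounded_variation h T"
  unfolding has_bounded_variation_def
  by (rule bdd_above_mono) (auto intro: interval_family_mono)

lemma variation_sum_le_total_variation:
  "has_bounded_variation h S \<Longrightarrow> interval_family S D \<Longrightarrow> variation_sum h D \<le> total_variation h S"
  unfolding total_variation_def has_bounded_variation_def by (rule cSUP_upper) auto

lemma total_variation_le:
  "(\<And>D. interval_family S D \<Longrightarrow> variation_sum h D \<le> B) \<Longrightarrow> total_variation h S \<le> B"
  unfolding total_variation_def by (rule cSUP_least) (auto intro: interval_family_empty[of S])

lemma total_variation_approx:
  assumes "e > 0"
  obtains D where "interval_family S D" "total_variation h S - e < variation_sum h D"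
proof -
  have "\<not> (\<forall>D. interval_family S D \<longrightarrow> variation_sum h D \<le> total_variation h S - e)"
  proof
    assume "\<forall>D. interval_family S D \<longrightarrow> variation_sum h D \<le> total_variation h S - e"
    then have "total_variation h S \<le> total_variation h S - e"
      by (intro total_variation_le) auto
    with assms show False by simp
  qed
  with that show thesis by (auto simp: not_le)
qed

text \<open>The lengths are the Lebesgue measures of disjoint open intervals contained in
  {x..y}.\<close>

lemma interval_family_length_le:
  assumes "interval_family {x..y} D" "x \<le> y"
  shows "(\<Sum>(u, v)\<in>D. v - u) \<le> y - x"
proof -
  let ?A = "\<lambda>p::real \<times> real. {fst p<..<snd p}"
  have fin: "finite D" and D: "\<And>p. p \<in> D \<Longrightarrow> fst p < snd p \<and> {fst p..snd p} \<subseteq> {x..y}"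
    using assms by (auto simp: interval_family_def)
  have disj: "disjoint_family_on ?A D"
    using assms(1) unfolding interval_family_def disjoint_family_on_def pairwise_def
    by (fastforce simp: split_beta)
  have "(\<Sum>(u, v)\<in>D. v - u) = (\<Sum>p\<in>D. measure lborel (?A p))"
    using D by (intro sum.cong) (auto simp: split_beta measure_def less_imp_le)
  also have "\<dots> = measure lborel (\<Union>p\<in>D. ?A p)"
    using D by (intro measure_finite_Union[symmetric] fin disj) (auto simp: less_imp_le)
  also have "\<dots> \<le> measure lborel {x..y}"
  proof (rule measure_mono_fmeasurable)
    show "(\<Union>p\<in>D. ?A p) \<subseteq> {x..y}"
      using D by fastforce
  qed (auto simp: fin fmeasurable_def emeasure_lborel_Icc_eq)
  also have "\<dots> = y - x" using assms by simp
  finally show ?thesis .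
qed

text \<open>Every interval is clipped at x. One that straddles x is replaced by two pieces, and the
  triangle inequality shows that the variation sum does not decrease. The strict conditions in
  \<open>L\<close> and \<open>R\<close> discard exactly the clippings that would be
  degenerate.\<close>

lemma interval_family_split:
  assumes D: "interval_family {p..y} D"
  obtains D1 D2 where "interval_family {p..x} D1" "interval_family {x..y} D2"
    "variation_sum h D \<le> variation_sum h D1 + variation_sum h D2"
proof -
  define L where "L = {d\<in>D. fst d < x}"
  define R where "R = {d\<in>D. x < snd d}"
  define l where "l d = (fst d, min (snd d) x)" for d :: "real \<times> real"
  define r where "r d = (max (fst d) x, snd d)" for d :: "real \<times> real"
  have fin: "finite D" and D': "\<And>d. d \<in> D \<Longrightarrow> fst d < snd d \<and> p \<le> fst d \<and> snd d \<le> y"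
    using D unfolding interval_family_def by (fastforce simp: split_beta)+
  have disj: "{fst d<..<snd d} \<inter> {fst d'<..<snd d'} = {}" if "d \<in> D" "d' \<in> D" "d \<noteq> d'" for d d'
    using D that unfolding interval_family_def pairwise_def by (auto simp: split_beta)
  \<comment> \<open>Two members sharing an interior point are equal. This makes clipping injective,
    since equal clipped intervals are nonempty and lie in both originals.\<close>
  have ne: "d = d'" if "d \<in> D" "d' \<in> D" "max (fst d) (fst d') < min (snd d) (snd d')" for d d'
    using disj[OF that(1,2)] dense[OF that(3)] by (metis IntI empty_iff greaterThanLessThan_iff max_less_iff_conj min_less_iff_conj)
  have injl: "inj_on l L"
  proof (rule inj_onI)
    fix d d' assume "d \<in> L" "d' \<in> L" "l d = l d'"
    then show "d = d'"
      using D'[of d] D'[of d'] by (intro ne) (auto simp: L_def l_def max_def min_def split: if_splits)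
  qed
  have injr: "inj_on r R"
  proof (rule inj_onI)
    fix d d' assume "d \<in> R" "d' \<in> R" "r d = r d'"
    then show "d = d'"
      using D'[of d] D'[of d'] by (intro ne) (auto simp: R_def r_def max_def min_def split: if_splits)
  qed
  have 1: "interval_family {p..x} (l ` L)"
    unfolding interval_family_def
  proof (intro conjI)
    show "\<forall>(u, v)\<in>l ` L. u < v \<and> {u..v} \<subseteq> {p..x}"
      using D' by (force simp: l_def L_def)
    show "pairwise (\<lambda>(u, v) (u', v'). {u<..<v} \<inter> {u'<..<v'} = {}) (l ` L)"
    proof (rule pairwiseI)
      fix c c' assume "c \<in> l ` L" "c' \<in> l ` L" "c \<noteq> c'"
      then obtain d d' where "d \<in> L" "d' \<in> L" "c = l d" "c' = l d'" "d \<noteq> d'" by auto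
      then show "(\<lambda>(u, v) (u', v'). {u<..<v} \<inter> {u'<..<v'} = {}) c c'"
        using disj[of d d'] unfolding split_beta by (fastforce simp: L_def l_def)
    qed
  qed (use fin in \<open>auto simp: L_def\<close>)
  have 2: "interval_family {x..y} (r ` R)"
    unfolding interval_family_def
  proof (intro conjI)
    show "\<forall>(u, v)\<in>r ` R. u < v \<and> {u..v} \<subseteq> {x..y}"
      using D' by (force simp: r_def R_def)
    show "pairwise (\<lambda>(u, v) (u', v'). {u<..<v} \<inter> {u'<..<v'} = {}) (r ` R)"
    proof (rule pairwiseI)
      fix c c' assume "c \<in> r ` R" "c' \<in> r ` R" "c \<noteq> c'"
      then obtain d d' where "d \<in> R" "d' \<in> R" "c = r d" "c' = r d'" "d \<noteq> d'" by auto
      then show "(\<lambda>(u, v) (u', v'). {u<..<v} \<inter> {u'<..<v'} = {}) c c'"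
        using disj[of d d'] unfolding split_beta by (fastforce simp: R_def r_def)
    qed
  qed (use fin in \<open>auto simp: R_def\<close>)
  have "variation_sum h D = (\<Sum>d\<in>D. \<bar>h (snd d) - h (fst d)\<bar>)"
    by (simp add: variation_sum_def split_beta)
  also have "\<dots> \<le> (\<Sum>d\<in>D. (if d \<in> L then \<bar>h (snd (l d)) - h (fst (l d))\<bar> else 0) +
      (if d \<in> R then \<bar>h (snd (r d)) - h (fst (r d))\<bar> else 0))"
  proof (rule sum_mono)
    fix d assume "d \<in> D"
    then show "\<bar>h (snd d) - h (fst d)\<bar> \<le>
        (if d \<in> L then \<bar>h (snd (l d)) - h (fst (l d))\<bar> else 0) +
        (if d \<in> R then \<bar>h (snd (r d)) - h (fst (r d))\<bar> else 0)"
      using D'[of d] by (auto simp: L_def R_def l_def r_def min_def max_def)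
  qed
  also have "\<dots> = (\<Sum>d\<in>L. \<bar>h (snd (l d)) - h (fst (l d))\<bar>) + (\<Sum>d\<in>R. \<bar>h (snd (r d)) - h (fst (r d))\<bar>)"
    by (simp add: sum.distrib sum.If_cases[OF fin] L_def R_def Int_def conj_commute)
  also have "\<dots> = variation_sum h (l ` L) + variation_sum h (r ` R)"
    by (simp add: variation_sum_def sum.reindex[OF injl] sum.reindex[OF injr] split_beta)
  finally show thesis using that 1 2 by blast
qed

text \<open>Refinement of a family: each interval is replaced by a family inside it. The sum over
  the union is the double sum because a pair common to two refinements would have its nonempty
  interior in two disjoint intervals.\<close>

lemma interval_family_UN:
  assumes D: "interval_family S D"
    and E: "\<And>u v. (u, v) \<in> D \<Longrightarrow> interval_family {u..v} (E (u, v))"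
  shows "interval_family S (\<Union>d\<in>D. E d)"
    and "(\<Sum>c\<in>(\<Union>d\<in>D. E d). f c) = (\<Sum>d\<in>D. \<Sum>c\<in>E d. f c :: real)"
proof -
  have fin: "finite D" and D': "\<And>d. d \<in> D \<Longrightarrow> fst d < snd d \<and> {fst d..snd d} \<subseteq> S"
    using D unfolding interval_family_def by (fastforce simp: split_beta)+
  have disj: "{fst d<..<snd d} \<inter> {fst d'<..<snd d'} = {}" if "d \<in> D" "d' \<in> D" "d \<noteq> d'" for d d'
    using D that unfolding interval_family_def pairwise_def by (auto simp: split_beta)
  have finE: "finite (E d)" and E': "\<And>c. c \<in> E d \<Longrightarrow> fst c < snd c \<and> fst d \<le> fst c \<and> snd c \<le> snd d"
    if "d \<in> D" for d
    using E[of "fst d" "snd d"] that unfolding interval_family_def by (fastforce simp: split_beta)+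
  have disjE: "{fst c<..<snd c} \<inter> {fst c'<..<snd c'} = {}"
    if "d \<in> D" "c \<in> E d" "c' \<in> E d" "c \<noteq> c'" for d c c'
    using E[of "fst d" "snd d"] that unfolding interval_family_def pairwise_def by (auto simp: split_beta)
  have sub: "{fst c<..<snd c} \<subseteq> {fst d<..<snd d}" if "d \<in> D" "c \<in> E d" for d c
    using E'[OF that] by auto
  show "interval_family S (\<Union>d\<in>D. E d)"
    unfolding interval_family_def
  proof (intro conjI)
    show "\<forall>(u, v)\<in>(\<Union>d\<in>D. E d). u < v \<and> {u..v} \<subseteq> S"
    proof clarify
      fix u v d1 d2 assume "(d1, d2) \<in> D" "(u, v) \<in> E (d1, d2)"
      with E'[of "(d1, d2)" "(u, v)"] D'[of "(d1, d2)"] show "u < v \<and> {u..v} \<subseteq> S" by auto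
    qed
    show "pairwise (\<lambda>(u, v) (u', v'). {u<..<v} \<inter> {u'<..<v'} = {}) (\<Union>d\<in>D. E d)"
    proof (rule pairwiseI)
      fix c c' assume "c \<in> (\<Union>d\<in>D. E d)" "c' \<in> (\<Union>d\<in>D. E d)" "c \<noteq> c'"
      then obtain d d' where "d \<in> D" "c \<in> E d" "d' \<in> D" "c' \<in> E d'" by auto
      then have "{fst c<..<snd c} \<inter> {fst c'<..<snd c'} = {}"
        using disjE[of d c c'] disj[of d d'] sub[of d c] sub[of d' c'] \<open>c \<noteq> c'\<close> by (cases "d = d'") blast+
      then show "(\<lambda>(u, v) (u', v'). {u<..<v} \<inter> {u'<..<v'} = {}) c c'"
        by (simp add: split_beta)
    qed
  qed (use fin finE in auto)
  show "(\<Sum>c\<in>(\<Union>d\<in>D. E d). f c) = (\<Sum>d\<in>D. \<Sum>c\<in>E d. f c)"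
  proof (rule sum.UNION_disjoint[OF fin])
    show "\<forall>d\<in>D. \<forall>d'\<in>D. d \<noteq> d' \<longrightarrow> E d \<inter> E d' = {}"
    proof (intro ballI impI, rule ccontr)
      fix d d' assume *: "d \<in> D" "d' \<in> D" "d \<noteq> d'" "E d \<inter> E d' \<noteq> {}"
      then obtain c where "c \<in> E d" "c \<in> E d'" by auto
      with sub[of d c] sub[of d' c] disj[of d d'] * have "{fst c<..<snd c} = {}" by blast
      moreover have "fst c < snd c" using E'[OF \<open>d \<in> D\<close> \<open>c \<in> E d\<close>] by simp
      ultimately show False by simp
    qed
  qed (use finE in auto)
qed

lemma abs_cont_onD:
  assumes "abs_cont_on S h" "e > 0"
  obtains d where "d > 0"
    "\<And>D. interval_family S D \<Longrightarrow> (\<Sum>(u, v)\<in>D. v - u) < d \<Longrightarrow> variation_sum h D < e"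
proof -
  from assms obtain d where d: "d > 0"
    "\<And>D :: (real \<times> real) set. finite D \<and> (\<forall>(u, v)\<in>D. u \<le> v \<and> {u..v} \<subseteq> S) \<and>
        pairwise (\<lambda>(u, v) (u', v'). {u<..<v} \<inter> {u'<..<v'} = {}) D \<and>
        (\<Sum>(u, v)\<in>D. v - u) < d \<Longrightarrow> (\<Sum>(u, v)\<in>D. \<bar>h v - h u\<bar>) < e"
    unfolding abs_cont_on_def by meson
  show thesis
  proof (rule that[OF d(1)])
    fix D assume "interval_family S D" "(\<Sum>(u, v)\<in>D. v - u) < d"
    then show "variation_sum h D < e"
      unfolding variation_sum_def by (intro d(2)) (fastforce simp: interval_family_def)
  qed
qed

text \<open>With d chosen for tolerance 1, cells of length d/2 cover {p..q}, and each cell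
  contributes at most 1 to any variation sum.\<close>

lemma abs_cont_on_imp_has_bounded_variation:
  assumes h: "abs_cont_on {p..q} h"
  shows "has_bounded_variation h {p..q}"
proof -
  obtain d where d: "d > 0"
    "\<And>D. interval_family {p..q} D \<Longrightarrow> (\<Sum>(u, v)\<in>D. v - u) < d \<Longrightarrow> variation_sum h D < 1"
    using abs_cont_onD[OF h, of 1] by auto
  \<comment> \<open>Induction on the number of cells to the left of y. Cells have length d/2 because
    the tolerance condition asks for total length strictly below d.\<close>
  have step: "variation_sum h D \<le> real n" if "interval_family {p..y} D" "p \<le> y" "y \<le> q" "y \<le> p + real n * (d/2)"
    for n y D
    using that
  proof (induction n arbitrary: y D)
    case 0
    then have "D = {}"
      by (intro interval_family_degenerate[of y p]) auto
    then show ?case by (simp add: variation_sum_def)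
  next
    case (Suc n)
    \<comment> \<open>The last cell is {x..y}; the maximum stops it at p when less than a full cell
      remains.\<close>
    define x where "x = max p (y - d/2)"
    obtain D1 D2 where D: "interval_family {p..x} D1" "interval_family {x..y} D2"
      "variation_sum h D \<le> variation_sum h D1 + variation_sum h D2"
      by (rule interval_family_split[OF Suc.prems(1), of x h])
    have "variation_sum h D1 \<le> real n"
      by (rule Suc.IH[OF D(1)]) (use Suc.prems d(1) in \<open>auto simp: x_def max_def field_simps\<close>)
    moreover have "variation_sum h D2 < 1"
    proof (rule d(2))
      show "interval_family {p..q} D2"
        by (rule interval_family_mono[OF D(2)]) (use Suc.prems in \<open>auto simp: x_def\<close>)
      have "(\<Sum>(u, v)\<in>D2. v - u) \<le> y - x"
        by (rule interval_family_length_le[OF D(2)]) (use Suc.prems d(1) in \<open>auto simp: x_def\<close>)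
      also have "\<dots> < d" using d(1) Suc.prems by (auto simp: x_def)
      finally show "(\<Sum>(u, v)\<in>D2. v - u) < d" .
    qed
    ultimately show ?case using D(3) by simp
  qed
  show ?thesis
  proof (cases "p \<le> q")
    case True
    obtain n where "(q - p) / (d/2) \<le> real n" using real_arch_simple by blast
    then have "q \<le> p + real n * (d/2)" using d(1) by (simp add: field_simps)
    with step[of q _ n] True show ?thesis
      unfolding has_bounded_variation_def by (intro bdd_aboveI2[of _ _ "real n"]) auto
  next
    case False
    then have "variation_sum h D \<le> 0" if "interval_family {p..q} D" for D
      using interval_family_degenerate[OF _ that] by (simp add: variation_sum_def)
    then show ?thesis
      unfolding has_bounded_variation_def by (intro bdd_aboveI2[of _ _ 0]) auto
  qed
qed

text \<open>One inequality cuts a family at x, the other joins nearly optimal families on the two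
  sides.\<close>

lemma total_variation_add:
  assumes h: "has_bounded_variation h {p..y}" and "p \<le> x" "x \<le> y"
  shows "total_variation h {p..y} = total_variation h {p..x} + total_variation h {x..y}"
proof (rule antisym)
  have bv: "has_bounded_variation h {p..x}" "has_bounded_variation h {x..y}"
    by (rule has_bounded_variation_mono[OF h]; use assms in auto)+
  show "total_variation h {p..y} \<le> total_variation h {p..x} + total_variation h {x..y}"
  proof (rule total_variation_le)
    fix D assume "interval_family {p..y} D"
    then obtain D1 D2 where D: "interval_family {p..x} D1" "interval_family {x..y} D2"
      "variation_sum h D \<le> variation_sum h D1 + variation_sum h D2"
      by (rule interval_family_split[of p y D x h])
    then show "variation_sum h D \<le> total_variation h {p..x} + total_variation h {x..y}"
      using variation_sum_le_total_variation[OF bv(1) D(1)] variation_sum_le_total_variation[OF bv(2) D(2)]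
      by linarith
  qed
  show "total_variation h {p..x} + total_variation h {x..y} \<le> total_variation h {p..y}"
  proof (cases "p < x \<and> x < y")
    \<comment> \<open>The family consisting of (p, x) and (x, y) is admissible only if both
      intervals are nondegenerate. Otherwise one summand is the variation over a point, which is at
      most 0.\<close>
    case False
    have 0: "total_variation h {z..z} \<le> 0" for z
    proof (rule total_variation_le)
      fix D assume "interval_family {z..z} D"
      then have "D = {}" by (rule interval_family_degenerate[OF order.refl])
      then show "variation_sum h D \<le> 0" by (simp add: variation_sum_def)
    qed
    show ?thesis using 0[of x] False assms by auto
  next
    case True
    show ?thesis
    proof (rule field_le_epsilon)
      fix e :: real assume "e > 0"
      obtain D1 where D1: "interval_family {p..x} D1" "total_variation h {p..x} - e/2 < variation_sum h D1"
        by (rule total_variation_approx[of "e/2"]) (use \<open>e > 0\<close> in auto)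
      obtain D2 where D2: "interval_family {x..y} D2" "total_variation h {x..y} - e/2 < variation_sum h D2"
        by (rule total_variation_approx[of "e/2"]) (use \<open>e > 0\<close> in auto)
      define E where "E d = (if d = (p, x) then D1 else D2)" for d
      have D: "interval_family {p..y} {(p, x), (x, y)}"
        using True by (auto simp: interval_family_def pairwise_def)
      have E: "interval_family {u..v} (E (u, v))" if "(u, v) \<in> {(p, x), (x, y)}" for u v
        using that True D1 D2 by (auto simp: E_def)
      have "variation_sum h D1 + variation_sum h D2 = variation_sum h (\<Union>d\<in>{(p, x), (x, y)}. E d)"
        unfolding variation_sum_def by (subst interval_family_UN(2)[OF D E]) (use True in \<open>simp_all add: E_def\<close>)
      also have "\<dots> \<le> total_variation h {p..y}"
        by (rule variation_sum_le_total_variation[OF h interval_family_UN(1)[OF D E]])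
      finally show "total_variation h {p..x} + total_variation h {x..y} \<le> total_variation h {p..y} + e"
        using D1 D2 by linarith
    qed
  qed
qed

lemma abs_diff_le_total_variation:
  assumes "has_bounded_variation h {x..y}" "x \<le> y"
  shows "\<bar>h y - h x\<bar> \<le> total_variation h {x..y}"
proof (cases "x = y")
  case True
  then show ?thesis
    using variation_sum_le_total_variation[OF assms(1) interval_family_empty] by (simp add: variation_sum_def)
next
  case False
  with assms variation_sum_le_total_variation[OF assms(1) interval_family_single[of x y]]
  show ?thesis by (simp add: variation_sum_def)
qed

text \<open>This is absolute continuity of the variation function x ->
  \<open>total_variation h {p..x}\<close>. Replacing each interval by a nearly optimal family inside
  it does not increase the total length, so the d for h serves again; passing to suprema weakens <
  to \<le>.\<close>

lemma abs_cont_on_sum_total_variation: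
  assumes h: "abs_cont_on {p..q} h" and "e > 0"
  obtains d where "d > 0"
    "\<And>D. interval_family {p..q} D \<Longrightarrow> (\<Sum>(u, v)\<in>D. v - u) < d \<Longrightarrow>
       (\<Sum>(u, v)\<in>D. total_variation h {u..v}) \<le> e"
proof -
  obtain d where d: "d > 0"
    "\<And>D. interval_family {p..q} D \<Longrightarrow> (\<Sum>(u, v)\<in>D. v - u) < d \<Longrightarrow> variation_sum h D < e"
    using abs_cont_onD[OF h \<open>e > 0\<close>] by blast
  show thesis
  proof (rule that[OF d(1)])
    fix D assume D: "interval_family {p..q} D" "(\<Sum>(u, v)\<in>D. v - u) < d"
    show "(\<Sum>(u, v)\<in>D. total_variation h {u..v}) \<le> e"
    proof (rule field_le_epsilon)
      fix e' :: real assume e': "e' > 0"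
      \<comment> \<open>The error e' is shared among the members of D; the summand 1 keeps the
        quotient meaningful for empty D.\<close>
      let ?e = "e' / (real (card D) + 1)"
      have "\<exists>E. interval_family {fst z..snd z} E \<and> total_variation h {fst z..snd z} - ?e < variation_sum h E" for z
        by (rule total_variation_approx[of ?e]) (use e' in auto)
      then obtain E where E: "\<And>z. interval_family {fst z..snd z} (E z)"
        "\<And>z. total_variation h {fst z..snd z} - ?e < variation_sum h (E z)" by metis
      have E1: "interval_family {u..v} (E (u, v))" for u v using E(1)[of "(u, v)"] by simp
      have "(\<Sum>(u, v)\<in>D. total_variation h {u..v}) \<le> (\<Sum>z\<in>D. variation_sum h (E z) + ?e)"
        unfolding split_beta by (rule sum_mono) (use E(2) in \<open>force simp: less_imp_le algebra_simps\<close>)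
      also have "\<dots> = variation_sum h (\<Union>z\<in>D. E z) + real (card D) * ?e"
        unfolding variation_sum_def interval_family_UN(2)[OF D(1) E1] by (simp add: sum.distrib)
      also have "real (card D) * ?e \<le> e'"
        using e' by (simp add: field_simps)
      also have "variation_sum h (\<Union>z\<in>D. E z) < e"
      proof (rule d(2)[OF interval_family_UN(1)[OF D(1) E1]])
        have "(\<Sum>(u, v)\<in>(\<Union>z\<in>D. E z). v - u) = (\<Sum>z\<in>D. \<Sum>(u, v)\<in>E z. v - u)"
          by (rule interval_family_UN(2)[OF D(1) E1])
        also have "\<dots> \<le> (\<Sum>z\<in>D. snd z - fst z)"
          using D(1) by (intro sum_mono interval_family_length_le E(1)) (auto simp: interval_family_def)
        also have "\<dots> < d" using D(2) by (simp add: split_beta)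
        finally show "(\<Sum>(u, v)\<in>(\<Union>z\<in>D. E z). v - u) < d" .
      qed
      finally show "(\<Sum>(u, v)\<in>D. total_variation h {u..v}) \<le> e + e'" by simp
    qed
  qed
qed

section \<open>Stieltjes measures of monotone absolutely continuous functions and their
  densities\<close>

text \<open>A Lebesgue null set inside (p, q) is covered by an open set of measure below d. The
  components of that set are disjoint intervals, so finitely many of them form an interval family of
  total length below d and carry Stieltjes mass at most e. Outside (p, q) the function G is constant
  and gives no mass.\<close>

lemma absolutely_continuous_interval_measure:
  fixes G :: "real \<Rightarrow> real"
  assumes "p \<le> q"
    and mono: "mono G" and cont: "continuous_on UNIV G"
    and const: "\<And>x. x \<le> p \<Longrightarrow> G x = G p" "\<And>x. q \<le> x \<Longrightarrow> G x = G q"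
    and ac: "\<And>e. e > 0 \<Longrightarrow> \<exists>d>0. \<forall>D. interval_family {p..q} D \<and> (\<Sum>(u, v)\<in>D. v - u) < d
               \<longrightarrow> (\<Sum>(u, v)\<in>D. G v - G u) \<le> e"
  shows "absolutely_continuous lborel (interval_measure G)"
proof -
  let ?M = "interval_measure G"
  have monoD: "G x \<le> G y" if "x \<le> y" for x y using mono that by (auto simp: mono_def)
  have cr: "continuous (at_right a) G" for a
    using cont continuous_on_eq_continuous_at[of UNIV G] continuous_at_imp_continuous_within by blast
  have Ioc: "emeasure ?M {a<..b} = ennreal (G b - G a)" if "a \<le> b" for a b
    using emeasure_interval_measure_Ioc[OF that monoD cr] by simp
  have Icc: "emeasure ?M {a..b} = ennreal (G b - G a)" if "a \<le> b" for a b
    using emeasure_interval_measure_Icc[OF that monoD cont] by simp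
  have low: "emeasure ?M {..p} = 0"
  proof -
    have "emeasure ?M {p - real n..p} = 0" for n
      using Icc[of "p - real n" p] const(1)[of "p - real n"] by simp
    then have "emeasure ?M (\<Union>n. {p - real n..p}) = 0"
      by (intro emeasure_UN_eq_0) auto
    also have "(\<Union>n. {p - real n..p}) = {..p}"
    proof safe
      fix x assume "x \<le> p"
      obtain n where "p - x \<le> real n" using real_arch_simple by blast
      with \<open>x \<le> p\<close> show "x \<in> (\<Union>n. {p - real n..p})" by (auto intro!: exI[of _ n])
    qed auto
    finally show ?thesis .
  qed
  have high: "emeasure ?M {q..} = 0"
  proof -
    have "emeasure ?M {q..q + real n} = 0" for n
      using Icc[of q "q + real n"] const(2)[of "q + real n"] by simp
    then have "emeasure ?M (\<Union>n. {q..q + real n}) = 0"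
      by (intro emeasure_UN_eq_0) auto
    also have "(\<Union>n. {q..q + real n}) = {q..}"
    proof safe
      fix x assume "q \<le> x"
      obtain n where "x - q \<le> real n" using real_arch_simple by blast
      with \<open>q \<le> x\<close> show "x \<in> (\<Union>n. {q..q + real n})" by (auto intro!: exI[of _ n])
    qed auto
    finally show ?thesis .
  qed
  have "emeasure ?M N = 0" if N: "N \<in> sets borel" "emeasure lborel N = 0" for N
  proof -
    let ?N = "N \<inter> {p<..<q}"
    have "emeasure ?M ?N \<le> ennreal e" if "e > 0" for e :: real
    proof -
      obtain d where d: "d > 0" "\<And>D. interval_family {p..q} D \<Longrightarrow> (\<Sum>(u, v)\<in>D. v - u) < d
               \<Longrightarrow> (\<Sum>(u, v)\<in>D. G v - G u) \<le> e"
        using ac[OF \<open>e > 0\<close>] by blast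
      have N0: "emeasure lborel ?N = 0"
        using N emeasure_mono[of ?N N lborel] by simp
      \<comment> \<open>Outer regularity bounds only U0 minus the null set; adding back a null set
        keeps the measure below d.\<close>
      obtain U0 where U0: "open U0" "?N \<subseteq> U0" "emeasure lborel (U0 - ?N) < ennreal d"
        using outer_regular_lborel[of ?N d] N(1) d(1) by auto
      define U where "U = U0 \<inter> {p<..<q}"
      have U: "open U" "?N \<subseteq> U" "U \<subseteq> {p<..<q}" using U0 by (auto simp: U_def)
      have "emeasure lborel U \<le> emeasure lborel U0"
        using U0(1) by (intro emeasure_mono) (auto simp: U_def)
      also have "\<dots> \<le> emeasure lborel ((U0 - ?N) \<union> ?N)"
        using U0(1) N(1) by (intro emeasure_mono) (auto intro!: sets.Diff)
      also have "\<dots> \<le> emeasure lborel (U0 - ?N) + emeasure lborel ?N"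
        using U0(1) N(1) by (intro emeasure_subadditive) (auto intro!: sets.Diff)
      also have "\<dots> < d" using U0(3) N0 by simp
      finally have Ud: "emeasure lborel U < ennreal d" .
      \<comment> \<open>A component is connected, hence contains everything strictly between its
        infimum and supremum, and it is open, hence contains neither of them.\<close>
      have comp: "C = {Inf C<..<Sup C} \<and> Inf C < Sup C \<and> p \<le> Inf C \<and> Sup C \<le> q"
        if C: "C \<in> components U" for C
      proof -
        have "open C" using open_components[OF U(1) C] .
        have ne: "C \<noteq> {}" using in_components_nonempty[OF C] .
        have sub: "C \<subseteq> {p<..<q}" using in_components_subset[OF C] U(3) by blast
        have bdd: "bdd_below C" "bdd_above C"
          using sub by (auto intro!: bdd_belowI[of _ p] bdd_aboveI[of _ q] less_imp_le)
        have conn: "connected C" using in_components_connected[OF C] .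
        have "Inf C \<notin> C" "Sup C \<notin> C"
          using Inf_notin_open[OF \<open>open C\<close>, of p] Sup_notin_open[OF \<open>open C\<close>, of q] sub
          by (meson greaterThanLessThan_iff subsetD)+
        moreover have "{Inf C<..<Sup C} \<subseteq> C"
        proof
          fix x assume "x \<in> {Inf C<..<Sup C}"
          then obtain y z where "y \<in> C" "y < x" "z \<in> C" "x < z"
            using ne bdd by (auto simp: cInf_less_iff less_cSup_iff)
          then show "x \<in> C" using conn unfolding connected_iff_interval by (meson less_imp_le)
        qed
        moreover have "C \<subseteq> {Inf C..Sup C}"
          using bdd by (auto intro: cInf_lower cSup_upper)
        ultimately have eq: "C = {Inf C<..<Sup C}" by (auto simp: less_le)
        moreover have "Inf C < Sup C" using eq ne by (metis greaterThanLessThan_empty_iff not_le)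
        moreover have "p \<le> Inf C" using ne sub by (intro cInf_greatest) auto
        moreover have "Sup C \<le> q" using ne sub by (intro cSup_least) auto
        ultimately show ?thesis by blast
      qed
      have disj: "C \<inter> C' = {}" if "C \<in> components U" "C' \<in> components U" "C \<noteq> C'" for C C'
        using that components_nonoverlap by metis
      have cnt: "countable (components U)"
        by (rule countable_disjoint_open_subsets) (use U(1) open_components disj in \<open>auto simp: pairwise_def disjnt_def\<close>)
      have comp_borel: "C \<in> sets borel" if "C \<in> components U" for C
        using open_components[OF U(1) that] by (rule borel_open)
      \<comment> \<open>Absolute continuity speaks of finite families only, so the estimate is made
        for finitely many components and extended to all of U by continuity from below.\<close>
      have fin: "(\<Sum>C\<in>F. emeasure ?M C) \<le> ennreal e" if F: "finite F" "F \<subseteq> components U" for F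
      proof -
        let ?D = "(\<lambda>C. (Inf C, Sup C)) ` F"
        have inj: "inj_on (\<lambda>C. (Inf C, Sup C)) F"
          using comp F by (intro inj_onI) (metis prod.inject subsetD)
        have D: "interval_family {p..q} ?D"
          unfolding interval_family_def
        proof (intro conjI)
          show "\<forall>(u, v)\<in>?D. u < v \<and> {u..v} \<subseteq> {p..q}"
            using comp F by force
          show "pairwise (\<lambda>(u, v) (u', v'). {u<..<v} \<inter> {u'<..<v'} = {}) ?D"
          proof (rule pairwiseI)
            fix c c' assume "c \<in> ?D" "c' \<in> ?D" "c \<noteq> c'"
            then obtain C C' where *: "C \<in> F" "C' \<in> F" "c = (Inf C, Sup C)" "c' = (Inf C', Sup C')" by auto
            then have "C \<inter> C' = {}" using disj[of C C'] F \<open>c \<noteq> c'\<close> by auto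
            then show "(\<lambda>(u, v) (u', v'). {u<..<v} \<inter> {u'<..<v'} = {}) c c'"
              using comp[of C] comp[of C'] * F by (simp only: split_beta fst_conv snd_conv subset_iff)
          qed
        qed (use F in auto)
        have lt: "(\<Sum>(u, v)\<in>?D. v - u) < d"
        proof -
          have "ennreal (\<Sum>(u, v)\<in>?D. v - u) = (\<Sum>C\<in>F. ennreal (Sup C - Inf C))"
            using comp F by (subst sum.reindex[OF inj]) (auto simp: sum_ennreal subset_iff less_imp_le)
          also have "\<dots> = (\<Sum>C\<in>F. emeasure lborel C)"
            using comp F by (intro sum.cong) (metis emeasure_lborel_Ioo less_imp_le subsetD)+
          also have "\<dots> = emeasure lborel (\<Union>C\<in>F. C)"
            using F disj comp_borel by (intro sum_emeasure) (auto simp: disjoint_family_on_def subset_iff)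
          also have "\<dots> \<le> emeasure lborel U"
            using F U(1) in_components_subset by (intro emeasure_mono) auto
          finally show ?thesis using Ud by (meson ennreal_leI leD le_less_trans not_le)
        qed
        have "(\<Sum>C\<in>F. emeasure ?M C) \<le> (\<Sum>C\<in>F. ennreal (G (Sup C) - G (Inf C)))"
        proof (rule sum_mono)
          fix C assume "C \<in> F"
          then have C: "C = {Inf C<..<Sup C}" "Inf C < Sup C" using comp F by auto
          have "{Inf C<..<Sup C} \<subseteq> {Inf C<..Sup C}" by auto
          with C(1) have "C \<subseteq> {Inf C<..Sup C}" by metis
          then have "emeasure ?M C \<le> emeasure ?M {Inf C<..Sup C}"
            by (intro emeasure_mono) auto
          with Ioc C(2) show "emeasure ?M C \<le> ennreal (G (Sup C) - G (Inf C))" by simp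
        qed
        also have "\<dots> = ennreal (\<Sum>(u, v)\<in>?D. G v - G u)"
          using comp F monoD by (subst sum.reindex[OF inj]) (auto simp: sum_ennreal subset_iff less_imp_le)
        also have "\<dots> \<le> ennreal e" using d(2)[OF D lt] by (rule ennreal_leI)
        finally show ?thesis .
      qed
      have "emeasure ?M ?N \<le> emeasure ?M U"
        using U by (intro emeasure_mono) auto
      also have "\<dots> \<le> ennreal e"
      proof (cases "components U = {}")
        case True
        then have "U = {}" by simp
        then show ?thesis by simp
      next
        case False
        \<comment> \<open>Increasing finite unions along an enumeration of the components. The
          enumeration may repeat components, so the mass is later summed over its image as a
          set.\<close>
        define A where "A n = (\<Union>i\<le>n. from_nat_into (components U) i)" for n
        have cU: "from_nat_into (components U) i \<in> components U" for i
          using False by (rule from_nat_into)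
        have A: "range A \<subseteq> sets ?M" "incseq A"
          using cU comp_borel by (fastforce simp: A_def incseq_def)+
        have "U = \<Union>(range (from_nat_into (components U)))"
          by (simp only: range_from_nat_into[OF False cnt] Union_components)
        then have "U = (\<Union>n. A n)" by (auto simp: A_def)
        then have "emeasure ?M U = (SUP n. emeasure ?M (A n))"
          using SUP_emeasure_incseq[OF A] by simp
        also have "\<dots> \<le> ennreal e"
        proof (rule SUP_least)
          fix n
          let ?F = "from_nat_into (components U) ` {..n}"
          have "emeasure ?M (A n) \<le> (\<Sum>C\<in>?F. emeasure ?M C)"
            unfolding A_def using emeasure_subadditive_finite[of ?F "\<lambda>C. C" ?M] cU comp_borel
            by fastforce
          also have "\<dots> \<le> ennreal e" by (rule fin) (use cU in auto)
          finally show "emeasure ?M (A n) \<le> ennreal e" .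
        qed
        finally show ?thesis .
      qed
      finally show ?thesis .
    qed
    then have "emeasure ?M ?N = 0"
      by (metis ennreal_0 ennreal_le_epsilon add_0 le_zero_eq)
    moreover have "emeasure ?M N \<le> emeasure ?M (?N \<union> ({..p} \<union> {q..}))"
      using N(1) by (intro emeasure_mono) auto
    moreover have "\<dots> \<le> emeasure ?M ?N + (emeasure ?M {..p} + emeasure ?M {q..})"
      using N(1) by (intro order.trans[OF emeasure_subadditive] add_left_mono emeasure_subadditive) auto
    ultimately show ?thesis using low high by simp
  qed
  then show ?thesis by (auto simp: absolutely_continuous_def null_sets_def)
qed

text \<open>The density is the Radon-Nikodym derivative of the Stieltjes measure with respect to
  Lebesgue measure.\<close>

lemma mono_abs_cont_has_density:
  fixes G :: "real \<Rightarrow> real"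
  assumes "p \<le> q"
    and mono: "\<And>x y. p \<le> x \<Longrightarrow> x \<le> y \<Longrightarrow> y \<le> q \<Longrightarrow> G x \<le> G y"
    and ac: "\<And>e. e > 0 \<Longrightarrow> \<exists>d>0. \<forall>D. interval_family {p..q} D \<and> (\<Sum>(u, v)\<in>D. v - u) < d
               \<longrightarrow> (\<Sum>(u, v)\<in>D. G v - G u) \<le> e"
  obtains g where "integrable lborel g"
    "\<And>x y. p \<le> x \<Longrightarrow> x \<le> y \<Longrightarrow> y \<le> q \<Longrightarrow> integral {x..y} g = G y - G x"
proof -
  \<comment> \<open>The hypotheses control G on {p..q} only; clamping the argument gives a monotone
    continuous function on the line that is constant beyond both ends.\<close>
  define H where "H x = G (max p (min q x))" for x
  have HG: "H x = G x" if "p \<le> x" "x \<le> q" for x using that by (simp add: H_def)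
  have mH: "mono H" unfolding mono_def H_def using \<open>p \<le> q\<close> by (auto intro!: mono)
  have cont: "continuous_on UNIV H"
  proof (rule uniformly_continuous_imp_continuous, unfold uniformly_continuous_on_def, intro allI impI)
    fix e :: real assume "e > 0"
    then obtain d where d: "d > 0" "\<And>D. interval_family {p..q} D \<Longrightarrow> (\<Sum>(u, v)\<in>D. v - u) < d
               \<Longrightarrow> (\<Sum>(u, v)\<in>D. G v - G u) \<le> e/2"
      using ac[of "e/2"] by auto
    have *: "H y - H x < e" if "x \<le> y" "y - x < d" for x y
    proof -
      let ?x = "max p (min q x)" and ?y = "max p (min q y)"
      show ?thesis
      proof (cases "?x < ?y")
        case True
        have "(\<Sum>(u, v)\<in>{(?x, ?y)}. G v - G u) \<le> e/2"
          by (rule d(2)[OF interval_family_single[OF True]]) (use that \<open>p \<le> q\<close> in auto)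
        then show ?thesis using \<open>e > 0\<close> by (simp add: H_def)
      next
        case False
        then have "?x = ?y" using that by auto
        then show ?thesis using \<open>e > 0\<close> by (simp add: H_def)
      qed
    qed
    have "dist (H y) (H x) < e" if "dist y x < d" for x y
      using *[of x y] *[of y x] that monoD[OF mH, of x y] monoD[OF mH, of y x]
      by (cases "x \<le> y") (auto simp: dist_real_def)
    with d(1) show "\<exists>d>0. \<forall>x\<in>UNIV. \<forall>x'\<in>UNIV. dist x' x < d \<longrightarrow> dist (H x') (H x) < e" by blast
  qed
  let ?M = "interval_measure H"
  have "absolutely_continuous lborel ?M"
  proof (rule absolutely_continuous_interval_measure[OF \<open>p \<le> q\<close> mH cont])
    fix e :: real assume "e > 0"
    from ac[OF this] obtain d where d: "d > 0" "\<And>D. interval_family {p..q} D \<Longrightarrow> (\<Sum>(u, v)\<in>D. v - u) < d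
               \<Longrightarrow> (\<Sum>(u, v)\<in>D. G v - G u) \<le> e" by blast
    have "(\<Sum>(u, v)\<in>D. H v - H u) = (\<Sum>(u, v)\<in>D. G v - G u)" if "interval_family {p..q} D" for D
      using that by (intro sum.cong) (force simp: interval_family_def HG)+
    with d show "\<exists>d>0. \<forall>D. interval_family {p..q} D \<and> (\<Sum>(u, v)\<in>D. v - u) < d
               \<longrightarrow> (\<Sum>(u, v)\<in>D. H v - H u) \<le> e" by auto
  qed (use \<open>p \<le> q\<close> in \<open>auto simp: H_def max_def min_def\<close>)
  then obtain f where f: "f \<in> borel_measurable lborel" "density lborel f = ?M"
    using sigma_finite_measure.Radon_Nikodym[OF sigma_finite_lborel, of ?M] by auto
  have Icc: "emeasure ?M {a..b} = ennreal (H b - H a)" if "a \<le> b" for a b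
    using emeasure_interval_measure_Icc[OF that _ cont] mH by (auto simp: mono_def)
  \<comment> \<open>The Radon-Nikodym derivative f may take the value infinity, which
    \<open>enn2real\<close> sends to 0. On {p..q} this affects only a null set, because the mass
    there is finite; see \<open>AEf\<close>.\<close>
  define g where "g x = (if x \<in> {p..q} then enn2real (f x) else 0)" for x
  have [measurable]: "f \<in> borel_measurable borel" using f by simp
  have mg: "g \<in> borel_measurable borel" unfolding g_def by measurable
  have fI: "(\<integral>\<^sup>+t\<in>{x..y}. f t \<partial>lborel) = ennreal (H y - H x)" if "x \<le> y" for x y
    using Icc[OF that] f by (subst emeasure_density[symmetric]) auto
  have AEf: "AE t in lborel. t \<in> {p..q} \<longrightarrow> f t \<noteq> \<infinity>"
  proof -
    have "AE t in lborel. f t * indicator {p..q} t \<noteq> \<infinity>"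
      using fI[OF \<open>p \<le> q\<close>] by (intro nn_integral_PInf_AE) auto
    then show ?thesis by eventually_elim (auto simp: indicator_def)
  qed
  have gI: "(\<integral>\<^sup>+t\<in>{x..y}. ennreal (g t) \<partial>lborel) = ennreal (G y - G x)" if "p \<le> x" "x \<le> y" "y \<le> q" for x y
  proof -
    have "(\<integral>\<^sup>+t\<in>{x..y}. ennreal (g t) \<partial>lborel) = (\<integral>\<^sup>+t\<in>{x..y}. f t \<partial>lborel)"
      by (rule nn_integral_cong_AE) (use AEf in \<open>eventually_elim, use that in \<open>auto simp: g_def indicator_def less_top\<close>\<close>)
    then show ?thesis using fI that HG by simp
  qed
  have "integrable lborel g"
  proof (rule integrableI_nonneg)
    have "(\<integral>\<^sup>+t. ennreal (g t) \<partial>lborel) = (\<integral>\<^sup>+t\<in>{p..q}. ennreal (g t) \<partial>lborel)"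
      by (rule nn_integral_cong) (auto simp: g_def indicator_def)
    also have "\<dots> < \<infinity>" using gI[of p q] \<open>p \<le> q\<close> by simp
    finally show "(\<integral>\<^sup>+t. ennreal (g t) \<partial>lborel) < \<infinity>" .
  qed (use mg in \<open>auto simp: g_def\<close>)
  moreover have "integral {x..y} g = G y - G x" if "p \<le> x" "x \<le> y" "y \<le> q" for x y
  proof -
    have "((\<lambda>t. if t \<in> {x..y} then g t else 0) has_integral (G y - G x)) UNIV"
    proof (rule nn_integral_has_integral)
      have "(\<integral>\<^sup>+t. ennreal (if t \<in> {x..y} then g t else 0) \<partial>lborel) = (\<integral>\<^sup>+t\<in>{x..y}. ennreal (g t) \<partial>lborel)"
        by (rule nn_integral_cong) (auto simp: indicator_def)
      then show "(\<integral>\<^sup>+t. ennreal (if t \<in> {x..y} then g t else 0) \<partial>lborel) = ennreal (G y - G x)"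
        using gI[OF that] by simp
    qed (use mg mono[OF that] in \<open>auto simp: g_def\<close>)
    then have "(g has_integral (G y - G x)) {x..y}"
      by (simp only: has_integral_restrict_UNIV)
    then show ?thesis by (rule integral_unique)
  qed
  ultimately show thesis using that by blast
qed

section \<open>Differentiation of absolutely continuous functions\<close>

text \<open>Jordan decomposition: with V the variation function, h = V - (V - h), and both terms are
  nondecreasing and absolutely continuous on {p..q}.\<close>

lemma abs_cont_on_has_density:
  assumes h: "abs_cont_on {p..q} h" and "p \<le> q"
  obtains g where "integrable lborel g"
    "\<And>x y. p \<le> x \<Longrightarrow> x \<le> y \<Longrightarrow> y \<le> q \<Longrightarrow> integral {x..y} g = h y - h x"
proof -
  define V where "V x = total_variation h {p..x}" for x
  have bv: "has_bounded_variation h {x..y}" if "p \<le> x" "y \<le> q" for x y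
    by (rule has_bounded_variation_mono[OF abs_cont_on_imp_has_bounded_variation[OF h]]) (use that in auto)
  have V: "V y - V x = total_variation h {x..y}" if "p \<le> x" "x \<le> y" "y \<le> q" for x y
    unfolding V_def using total_variation_add[OF bv that(1,2)] that by simp
  have hV: "\<bar>h y - h x\<bar> \<le> V y - V x" if "p \<le> x" "x \<le> y" "y \<le> q" for x y
    using abs_diff_le_total_variation[OF bv] V that by simp
  have VD: "(\<Sum>(u, v)\<in>D. V v - V u) = (\<Sum>(u, v)\<in>D. total_variation h {u..v})"
    if "interval_family {p..q} D" for D
    using that by (intro sum.cong) (force simp: interval_family_def V)+
  obtain g1 where g1: "integrable lborel g1"
    "\<And>x y. p \<le> x \<Longrightarrow> x \<le> y \<Longrightarrow> y \<le> q \<Longrightarrow> integral {x..y} g1 = V y - V x"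
  proof (rule mono_abs_cont_has_density[OF \<open>p \<le> q\<close>, of V])
    show "V x \<le> V y" if "p \<le> x" "x \<le> y" "y \<le> q" for x y using hV[OF that] by linarith
    fix e :: real assume "e > 0"
    then obtain d where "d > 0" "\<And>D. interval_family {p..q} D \<Longrightarrow> (\<Sum>(u, v)\<in>D. v - u) < d \<Longrightarrow>
       (\<Sum>(u, v)\<in>D. total_variation h {u..v}) \<le> e"
      by (rule abs_cont_on_sum_total_variation[OF h]) blast
    then show "\<exists>d>0. \<forall>D. interval_family {p..q} D \<and> (\<Sum>(u, v)\<in>D. v - u) < d \<longrightarrow>
        (\<Sum>(u, v)\<in>D. V v - V u) \<le> e"
      using VD by (intro exI[of _ d]) auto
  qed blast
  obtain g2 where g2: "integrable lborel g2"
    "\<And>x y. p \<le> x \<Longrightarrow> x \<le> y \<Longrightarrow> y \<le> q \<Longrightarrow> integral {x..y} g2 = (V y - h y) - (V x - h x)"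
  proof (rule mono_abs_cont_has_density[OF \<open>p \<le> q\<close>, of "\<lambda>x. V x - h x"])
    show "V x - h x \<le> V y - h y" if "p \<le> x" "x \<le> y" "y \<le> q" for x y using hV[OF that] by linarith
    fix e :: real assume "e > 0"
    \<comment> \<open>Half the tolerance suffices because an increment of V - h is at most twice the
      increment of V.\<close>
    obtain d where d: "d > 0" "\<And>D. interval_family {p..q} D \<Longrightarrow> (\<Sum>(u, v)\<in>D. v - u) < d \<Longrightarrow>
       (\<Sum>(u, v)\<in>D. total_variation h {u..v}) \<le> e/2"
      by (rule abs_cont_on_sum_total_variation[OF h, of "e/2"]) (use \<open>e > 0\<close> in auto)
    have "(\<Sum>(u, v)\<in>D. (V v - h v) - (V u - h u)) \<le> e"
      if D: "interval_family {p..q} D" "(\<Sum>(u, v)\<in>D. v - u) < d" for D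
    proof -
      have "(\<Sum>(u, v)\<in>D. (V v - h v) - (V u - h u)) \<le> (\<Sum>(u, v)\<in>D. 2 * total_variation h {u..v})"
      proof (rule sum_mono, clarify)
        fix u v assume "(u, v) \<in> D"
        then have "p \<le> u" "u \<le> v" "v \<le> q" using D(1) by (force simp: interval_family_def)+
        then show "(V v - h v) - (V u - h u) \<le> 2 * total_variation h {u..v}"
          using hV[of u v] V[of u v] by linarith
      qed
      also have "\<dots> = 2 * (\<Sum>(u, v)\<in>D. total_variation h {u..v})"
        by (simp add: sum_distrib_left split_beta)
      also have "\<dots> \<le> e" using d(2)[OF D] by simp
      finally show ?thesis .
    qed
    with d(1) show "\<exists>d>0. \<forall>D. interval_family {p..q} D \<and> (\<Sum>(u, v)\<in>D. v - u) < d \<longrightarrow>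
        (\<Sum>(u, v)\<in>D. (V v - h v) - (V u - h u)) \<le> e" by blast
  qed blast
  have int: "g integrable_on {x..y}" if "integrable lborel g" for g :: "real \<Rightarrow> real" and x y
    by (rule integrable_on_subinterval[OF integrable_on_lborel[OF that]]) auto
  show thesis
  proof (rule that[of "\<lambda>t. g1 t - g2 t"])
    show "integrable lborel (\<lambda>t. g1 t - g2 t)" using g1 g2 by auto
    show "integral {x..y} (\<lambda>t. g1 t - g2 t) = h y - h x" if "p \<le> x" "x \<le> y" "y \<le> q" for x y
      using g1(2)[OF that] g2(2)[OF that] by (subst integral_diff) (auto intro!: int g1 g2)
  qed
qed

text \<open>Lebesgue differentiation, in a form that controls averages over intervals to the right
  of a point. Applied to g it gives the right derivative of F, applied to the reflected function t
  -> g (- t) the left one.\<close>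

lemma indefinite_integral_has_derivative_negligible:
  fixes g :: "real \<Rightarrow> real"
  assumes g: "integrable lborel g"
    and F: "\<And>x y. p \<le> x \<Longrightarrow> x \<le> y \<Longrightarrow> y \<le> q \<Longrightarrow> integral {x..y} g = F y - F x"
  obtains N where "negligible N" "\<And>x. x \<notin> N \<Longrightarrow> p < x \<Longrightarrow> x < q \<Longrightarrow> (F has_real_derivative g x) (at x)"
proof -
  have int: "g integrable_on {x..y}" for x y
    by (rule integrable_on_subinterval[OF integrable_on_lborel[OF g]]) auto
  have int': "(\<lambda>t. g (- t)) integrable_on {x..y}" for x y
    using Henstock_Kurzweil_Integration.integrable_reflect_real[where f=g and a="- y" and b="- x"] int[of "- y" "- x"] by simp
  obtain N1 where N1: "negligible N1"
    "\<And>x e. x \<notin> N1 \<Longrightarrow> 0 < e \<Longrightarrow> \<exists>d>0. \<forall>h. 0 < h \<and> h < d \<longrightarrow>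
       norm (integral (cbox x (x + h *\<^sub>R One)) g /\<^sub>R h ^ DIM(real) - g x) < e"
    by (rule integrable_ccontinuous_explicit[of g]) (use int in auto)
  obtain N2 where N2: "negligible N2"
    "\<And>x e. x \<notin> N2 \<Longrightarrow> 0 < e \<Longrightarrow> \<exists>d>0. \<forall>h. 0 < h \<and> h < d \<longrightarrow>
       norm (integral (cbox x (x + h *\<^sub>R One)) (\<lambda>t. g (- t)) /\<^sub>R h ^ DIM(real) - g (- x)) < e"
    by (rule integrable_ccontinuous_explicit[of "\<lambda>t. g (- t)"])
       (use int' in auto)
  \<comment> \<open>\<open>N2\<close> is exceptional for the reflected function at - x, so it has to
    be reflected back; the image of a negligible set under a differentiable map is
    negligible.\<close>
  let ?N = "N1 \<union> uminus ` N2"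
  have "negligible (uminus ` N2)"
    by (rule negligible_differentiable_image_negligible[OF order.refl N2(1)])
      (auto intro!: derivative_intros simp: differentiable_on_def)
  with N1(1) have "negligible ?N" by (rule negligible_Un)
  moreover have "(F has_real_derivative g x) (at x)" if x: "x \<notin> ?N" "p < x" "x < q" for x
    unfolding DERIV_def LIM_def
  proof (intro allI impI)
    fix e :: real assume "e > 0"
    obtain d1 where d1: "d1 > 0" "\<And>h. 0 < h \<Longrightarrow> h < d1 \<Longrightarrow> \<bar>integral {x..x + h} g / h - g x\<bar> < e"
      using N1(2)[of x e] x \<open>e > 0\<close> by (auto simp: divide_inverse_commute)
    have "- x \<notin> N2" using x by force
    then obtain d2 where d2: "d2 > 0"
      "\<And>h. 0 < h \<Longrightarrow> h < d2 \<Longrightarrow> \<bar>integral {- x..- x + h} (\<lambda>t. g (- t)) / h - g x\<bar> < e"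
      using N2(2)[of "- x" e] \<open>e > 0\<close> by (auto simp: divide_inverse_commute)
    have left: "integral {- x..- x + h} (\<lambda>t. g (- t)) = integral {x - h..x} g" for h
      using Henstock_Kurzweil_Integration.integral_reflect_real[where f=g and a="x - h" and b=x] by simp
    let ?d = "min (min d1 d2) (min (x - p) (q - x))"
    have "\<bar>(F (x + h) - F x) / h - g x\<bar> < e" if h: "h \<noteq> 0" "\<bar>h\<bar> < ?d" for h
    proof (cases "h > 0")
      case True
      then have "F (x + h) - F x = integral {x..x + h} g" using h x by (intro F[symmetric]) auto
      with d1(2)[of h] True h show ?thesis by simp
    next
      case False
      with h have h': "0 < - h" "- h < d2" by auto
      have "F x - F (x + h) = integral {x + h..x} g" using h h' x by (intro F[symmetric]) auto
      moreover have "integral {- x..- x + (- h)} (\<lambda>t. g (- t)) = integral {x + h..x} g" using left[of "- h"] by simp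
      moreover have "(F (x + h) - F x) / h = (F x - F (x + h)) / (- h)" by (simp add: minus_divide_left[symmetric] diff_divide_distrib)
      ultimately show ?thesis using d2(2)[OF h'] by simp
    qed
    then show "\<exists>s>0. \<forall>h. h \<noteq> 0 \<and> dist h 0 < s \<longrightarrow> dist ((F (x + h) - F x) / h) (g x) < e"
      using d1(1) d2(1) x by (intro exI[of _ ?d]) (auto simp: dist_real_def)
  qed
  ultimately show thesis using that by blast
qed

text \<open>The last conclusion keeps only absolute values and nonnegative integrals of the
  fundamental theorem, the form in which Tonelli's theorem can use it.\<close>

lemma abs_cont_on_deriv:
  assumes h: "abs_cont_on {p..q} h" and "p \<le> q"
  obtains g where "integrable lborel g"
    "AE x in lborel. x \<in> {p<..<q} \<longrightarrow> (h has_real_derivative g x) (at x)"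
    "\<And>x y. p \<le> x \<Longrightarrow> x \<le> y \<Longrightarrow> y \<le> q \<Longrightarrow> ennreal \<bar>h y - h x\<bar> \<le> (\<integral>\<^sup>+t\<in>{x..y}. ennreal \<bar>g t\<bar> \<partial>lborel)"
proof -
  obtain g where g: "integrable lborel g"
    "\<And>x y. p \<le> x \<Longrightarrow> x \<le> y \<Longrightarrow> y \<le> q \<Longrightarrow> integral {x..y} g = h y - h x"
    using abs_cont_on_has_density[OF assms] by blast
  obtain N where N: "negligible N"
    "\<And>x. x \<notin> N \<Longrightarrow> p < x \<Longrightarrow> x < q \<Longrightarrow> (h has_real_derivative g x) (at x)"
    using indefinite_integral_has_derivative_negligible[OF g] by blast
  have "AE x in lebesgue. x \<in> {p<..<q} \<longrightarrow> (h has_real_derivative g x) (at x)"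
    by (rule AE_I'[of N]) (use N negligible_iff_null_sets in auto)
  then have "AE x in lborel. x \<in> {p<..<q} \<longrightarrow> (h has_real_derivative g x) (at x)"
    by (simp add: AE_completion_iff)
  moreover have "ennreal \<bar>h y - h x\<bar> \<le> (\<integral>\<^sup>+t\<in>{x..y}. ennreal \<bar>g t\<bar> \<partial>lborel)"
    if "p \<le> x" "x \<le> y" "y \<le> q" for x y
  proof -
    have si: "set_integrable lborel {x..y} g"
      using g(1) unfolding set_integrable_def by (intro integrable_mult_indicator) auto
    have "h y - h x = (LBINT t:{x..y}. g t)"
      using g(2)[OF that] set_borel_integral_eq_integral(2)[OF si] by simp
    also have "\<dots> = (LBINT t. indicator {x..y} t *\<^sub>R g t)"
      by (simp add: set_lebesgue_integral_def)
    finally have "ennreal \<bar>h y - h x\<bar> = ennreal (norm (LBINT t. indicator {x..y} t *\<^sub>R g t))" by simp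
    also have "\<dots> \<le> (\<integral>\<^sup>+t. norm (indicator {x..y} t *\<^sub>R g t) \<partial>lborel)"
      using si by (intro integral_norm_bound_ennreal) (simp add: set_integrable_def)
    also have "\<dots> = (\<integral>\<^sup>+t\<in>{x..y}. ennreal \<bar>g t\<bar> \<partial>lborel)"
      by (rule nn_integral_cong) (auto simp: indicator_def)
    finally show ?thesis .
  qed
  ultimately show thesis using that g(1) by blast
qed

section \<open>From compact subintervals to the open interval\<close>

lemma locally_abs_cont_on_subset:
  "locally_abs_cont_on S h \<Longrightarrow> {p..q} \<subseteq> S \<Longrightarrow> abs_cont_on {p..q} h"
  by (simp add: locally_abs_cont_on_def)

lemma abs_cont_on_imp_continuous_on:
  assumes h: "abs_cont_on {p..q} h"
  shows "continuous_on {p..q} h"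
  unfolding continuous_on_iff
proof (intro ballI allI impI)
  fix x e :: real assume x: "x \<in> {p..q}" and "e > 0"
  obtain d where d: "d > 0"
    "\<And>D. interval_family {p..q} D \<Longrightarrow> (\<Sum>(u, v)\<in>D. v - u) < d \<Longrightarrow> variation_sum h D < e"
    using abs_cont_onD[OF h \<open>e > 0\<close>] by blast
  have *: "\<bar>h v - h u\<bar> < e" if "u < v" "u \<in> {p..q}" "v \<in> {p..q}" "v - u < d" for u v
    using d(2)[of "{(u, v)}"] interval_family_single[of u v "{p..q}"] that by (auto simp: variation_sum_def)
  have "dist (h x') (h x) < e" if "x' \<in> {p..q}" "dist x' x < d" for x'
    using *[of x x'] *[of x' x] that x \<open>e > 0\<close>
    by (cases x x' rule: linorder_cases) (auto simp: dist_real_def)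
  with d(1) show "\<exists>d>0. \<forall>x'\<in>{p..q}. dist x' x < d \<longrightarrow> dist (h x') (h x) < e" by blast
qed

text \<open>The density of \<nu> is h^2, so increments of the square are the ones to be bounded. On
  the compact interval h is bounded by some B, and then h^2 varies at most 2 B times as much as
  h.\<close>

lemma abs_cont_on_power2:
  assumes h: "abs_cont_on {p..q} h"
  shows "abs_cont_on {p..q} (\<lambda>x. (h x)\<^sup>2)"
proof -
  have "bounded (h ` {p..q})"
    by (intro compact_imp_bounded compact_continuous_image abs_cont_on_imp_continuous_on[OF h]) auto
  then obtain B where B: "B > 0" "\<And>x. x \<in> {p..q} \<Longrightarrow> \<bar>h x\<bar> \<le> B"
    by (auto simp: bounded_pos)
  show ?thesis
    unfolding abs_cont_on_def
  proof (intro allI impI)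
    fix e :: real assume "e > 0"
    then have "e / (2 * B) > 0" using B by simp
    with h obtain d where d: "d > 0" "\<And>D :: (real \<times> real) set.
        finite D \<and> (\<forall>(u, v)\<in>D. u \<le> v \<and> {u..v} \<subseteq> {p..q}) \<and>
        pairwise (\<lambda>(u, v) (u', v'). {u<..<v} \<inter> {u'<..<v'} = {}) D \<and>
        (\<Sum>(u, v)\<in>D. v - u) < d \<Longrightarrow> (\<Sum>(u, v)\<in>D. \<bar>h v - h u\<bar>) < e / (2 * B)"
      unfolding abs_cont_on_def by meson
    show "\<exists>d>0. \<forall>D :: (real \<times> real) set. finite D \<and> (\<forall>(u, v)\<in>D. u \<le> v \<and> {u..v} \<subseteq> {p..q}) \<and>
        pairwise (\<lambda>(u, v) (u', v'). {u<..<v} \<inter> {u'<..<v'} = {}) D \<and>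
        (\<Sum>(u, v)\<in>D. v - u) < d \<longrightarrow> (\<Sum>(u, v)\<in>D. \<bar>(h v)\<^sup>2 - (h u)\<^sup>2\<bar>) < e"
    proof (intro exI[of _ d] conjI allI impI d(1))
      fix D :: "(real \<times> real) set"
      assume D: "finite D \<and> (\<forall>(u, v)\<in>D. u \<le> v \<and> {u..v} \<subseteq> {p..q}) \<and>
        pairwise (\<lambda>(u, v) (u', v'). {u<..<v} \<inter> {u'<..<v'} = {}) D \<and> (\<Sum>(u, v)\<in>D. v - u) < d"
      have "(\<Sum>(u, v)\<in>D. \<bar>(h v)\<^sup>2 - (h u)\<^sup>2\<bar>) \<le> (\<Sum>(u, v)\<in>D. 2 * B * \<bar>h v - h u\<bar>)"
      proof (rule sum_mono, clarify)
        fix u v assume "(u, v) \<in> D"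
        then have "u \<in> {p..q}" "v \<in> {p..q}" using D by fastforce+
        then have "\<bar>h v + h u\<bar> \<le> 2 * B" using B(2)[of u] B(2)[of v] by linarith
        then have "\<bar>h v + h u\<bar> * \<bar>h v - h u\<bar> \<le> 2 * B * \<bar>h v - h u\<bar>"
          by (rule mult_right_mono) simp
        also have "\<bar>h v + h u\<bar> * \<bar>h v - h u\<bar> = \<bar>(h v)\<^sup>2 - (h u)\<^sup>2\<bar>"
          by (simp add: abs_mult[symmetric] power2_eq_square algebra_simps)
        finally show "\<bar>(h v)\<^sup>2 - (h u)\<^sup>2\<bar> \<le> 2 * B * \<bar>h v - h u\<bar>" .
      qed
      also have "\<dots> = 2 * B * (\<Sum>(u, v)\<in>D. \<bar>h v - h u\<bar>)"
        by (simp add: sum_distrib_left split_beta)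
      also have "\<dots> < e" using d(2)[OF D] B(1) by (simp add: field_simps)
      finally show "(\<Sum>(u, v)\<in>D. \<bar>(h v)\<^sup>2 - (h u)\<^sup>2\<bar>) < e" .
    qed
  qed
qed

lemma einterval_Icc_subset:
  assumes "p \<in> einterval a b" "q \<in> einterval a b"
  shows "{p..q} \<subseteq> einterval a b"
proof
  fix t assume "t \<in> {p..q}"
  then have "ereal p \<le> ereal t" "ereal t \<le> ereal q" by auto
  with assms show "t \<in> einterval a b"
    unfolding einterval_iff by (meson le_less_trans less_le_trans)
qed

text \<open>Compact intervals with rational endpoints already surround every point, and countably
  many null sets have a null union.\<close>

lemma AE_on_einterval:
  assumes "\<And>p q. {p..q} \<subseteq> einterval a b \<Longrightarrow> AE x in lborel. x \<in> {p<..<q} \<longrightarrow> P x"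
  shows "AE x in lborel. x \<in> einterval a b \<longrightarrow> P x"
proof -
  have "AE x in lborel. \<forall>p\<in>\<rat>. \<forall>q\<in>\<rat>. {p..q} \<subseteq> einterval a b \<longrightarrow> x \<in> {p<..<q} \<longrightarrow> P x"
    using assms by (simp add: AE_ball_countable countable_rat)
  then show ?thesis
  proof eventually_elim
    case (elim x)
    show ?case
    proof
      assume "x \<in> einterval a b"
      then have "a < ereal x" "ereal x < b" by (auto simp: einterval_iff)
      then obtain r s :: rat where rs: "a < real_of_rat r" "real_of_rat r < ereal x"
        "ereal x < real_of_rat s" "real_of_rat s < b"
        using ereal_dense3 by meson
      have "{real_of_rat r..real_of_rat s} \<subseteq> einterval a b"
      proof (rule einterval_Icc_subset)
        have "ereal (real_of_rat r) < ereal (real_of_rat s)" using rs by auto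
        with rs show "real_of_rat r \<in> einterval a b" "real_of_rat s \<in> einterval a b"
          unfolding einterval_iff by (meson less_trans)+
      qed
      with elim rs show "P x" by (auto simp: Rats_def)
    qed
  qed
qed

lemma locally_abs_cont_on_imp_continuous_on:
  assumes h: "locally_abs_cont_on (einterval a b) h"
  shows "continuous_on (einterval a b) h"
proof (rule continuous_at_imp_continuous_on, rule ballI)
  fix x assume x: "x \<in> einterval a b"
  obtain e where e: "e > 0" "cball x e \<subseteq> einterval a b"
    using open_contains_cball[of "einterval a b"] x by auto
  then have "continuous_on {x - e..x + e} h"
    using locally_abs_cont_on_subset[OF h] abs_cont_on_imp_continuous_on by (auto simp: cball_eq_atLeastAtMost)
  then show "isCont h x"
    using e(1) by (intro continuous_on_interior[of "{x - e..x + e}"]) auto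
qed

text \<open>Each compact subinterval comes with a density of its own. A single Borel function is
  obtained as the limit of the difference quotients of h, which agrees with those densities wherever
  h is differentiable with them as derivative.\<close>

lemma locally_abs_cont_on_deriv:
  assumes h: "locally_abs_cont_on (einterval a b) h"
  obtains g where "g \<in> borel_measurable borel"
    "AE x in lborel. x \<in> einterval a b \<longrightarrow> (h has_real_derivative g x) (at x)"
proof -
  let ?I = "einterval a b"
  define k where "k x = (if x \<in> ?I then h x else 0)" for x
  \<comment> \<open>The increments 1/(n+1) tend to 0 without being 0. Using \<open>k\<close>, the
    extension of h by 0, makes the quotients Borel on the whole line; where they do not converge,
    the value of \<open>lim\<close> concerns only a null set of the interval.\<close>
  define g where "g x = lim (\<lambda>n. (k (x + inverse (real (Suc n))) - k x) / inverse (real (Suc n)))" for x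
  have [measurable]: "k \<in> borel_measurable borel"
    unfolding k_def
    by (rule borel_measurable_continuous_on_if)
      (use locally_abs_cont_on_imp_continuous_on[OF h] in auto)
  have "g \<in> borel_measurable borel"
    unfolding g_def by (intro borel_measurable_lim_metric) measurable
  moreover have "AE x in lborel. x \<in> ?I \<longrightarrow> (h has_real_derivative g x) (at x)"
  proof (rule AE_on_einterval)
    fix p q assume pq: "{p..q} \<subseteq> ?I"
    then have pq': "t \<in> ?I" if "p < t" "t < q" for t using that by (auto simp: subset_iff)
    show "AE x in lborel. x \<in> {p<..<q} \<longrightarrow> (h has_real_derivative g x) (at x)"
    proof (cases "p \<le> q")
      case True
      obtain d where "AE x in lborel. x \<in> {p<..<q} \<longrightarrow> (h has_real_derivative d x) (at x)"
        by (rule abs_cont_on_deriv[OF locally_abs_cont_on_subset[OF h pq] True])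
      then show ?thesis
      proof eventually_elim
        case (elim x)
        show ?case
        proof
          assume x: "x \<in> {p<..<q}"
          with elim have "(h has_real_derivative d x) (at x)" by simp
          moreover have "eventually (\<lambda>t. h t = k t) (nhds x)"
            using x pq' by (intro eventually_nhds[THEN iffD2] exI[of _ "{p<..<q}"]) (auto simp: k_def)
          ultimately have "(k has_real_derivative d x) (at x)"
            using DERIV_cong_ev[OF refl _ refl, of h k x "d x"] by simp
          then have "((\<lambda>t. (k (x + t) - k x) / t) \<longlongrightarrow> d x) (at 0)"
            by (simp add: DERIV_def)
          moreover have "filterlim (\<lambda>n. inverse (real (Suc n))) (at 0) sequentially"
            unfolding filterlim_at using LIMSEQ_inverse_real_of_nat by auto
          ultimately have "(\<lambda>n. (k (x + inverse (real (Suc n))) - k x) / inverse (real (Suc n))) \<longlonglongrightarrow> d x"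
            by (rule filterlim_compose)
          then have "g x = d x" unfolding g_def by (rule limI)
          with elim x show "(h has_real_derivative g x) (at x)" by simp
        qed
      qed
    qed auto
  qed
  ultimately show thesis using that by blast
qed

text \<open>The density of h^2 on {x..y} must be 2 h g almost everywhere, by the chain rule and
  uniqueness of derivatives.\<close>

lemma power2_increment_le_nn_integral:
  assumes h: "locally_abs_cont_on (einterval a b) h"
    and g: "AE x in lborel. x \<in> einterval a b \<longrightarrow> (h has_real_derivative g x) (at x)"
    and x: "x \<in> einterval a b" and y: "y \<in> einterval a b" and "x \<le> y"
  shows "ennreal \<bar>(h y)\<^sup>2 - (h x)\<^sup>2\<bar> \<le> (\<integral>\<^sup>+t\<in>{x..y}. ennreal (2 * \<bar>h t\<bar> * \<bar>g t\<bar>) \<partial>lborel)"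
proof -
  have sub: "{x..y} \<subseteq> einterval a b" by (rule einterval_Icc_subset[OF x y])
  obtain d where d: "AE t in lborel. t \<in> {x<..<y} \<longrightarrow> ((\<lambda>t. (h t)\<^sup>2) has_real_derivative d t) (at t)"
    "ennreal \<bar>(h y)\<^sup>2 - (h x)\<^sup>2\<bar> \<le> (\<integral>\<^sup>+t\<in>{x..y}. ennreal \<bar>d t\<bar> \<partial>lborel)"
    by (rule abs_cont_on_deriv[OF abs_cont_on_power2[OF locally_abs_cont_on_subset[OF h sub]] \<open>x \<le> y\<close>])
      (use \<open>x \<le> y\<close> in blast)
  have "(\<integral>\<^sup>+t\<in>{x..y}. ennreal \<bar>d t\<bar> \<partial>lborel) = (\<integral>\<^sup>+t\<in>{x..y}. ennreal (2 * \<bar>h t\<bar> * \<bar>g t\<bar>) \<partial>lborel)"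
  proof (rule nn_integral_cong_AE)
    show "AE t in lborel. ennreal \<bar>d t\<bar> * indicator {x..y} t
        = ennreal (2 * \<bar>h t\<bar> * \<bar>g t\<bar>) * indicator {x..y} t"
      \<comment> \<open>The derivative of h^2 is known on the open interval only, while the
        integrals run over the closed one; the two endpoints are null.\<close>
      using d(1) g AE_lborel_singleton[of x] AE_lborel_singleton[of y]
    proof eventually_elim
      case (elim t)
      show ?case
      proof (cases "t \<in> {x<..<y}")
        case True
        then have "((\<lambda>t. (h t)\<^sup>2) has_real_derivative 2 * h t * g t) (at t)"
          using elim(2) subsetD[OF sub, of t] by (auto intro!: derivative_eq_intros)
        then have "d t = 2 * h t * g t" using elim(1) True DERIV_unique by blast
        then show ?thesis by (simp add: abs_mult)
      qed (use elim in \<open>auto simp: indicator_def\<close>)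
    qed
  qed
  with d(2) show ?thesis by simp
qed

section \<open>Quantile coupling\<close>

text \<open>T is the generalized inverse of the distribution function, which sends uniform measure
  on (0, 1) to M. The last conclusion is its characteristic equivalence. To be measurable into M, T
  must also take its values inside the open interval and not merely in the reals.\<close>

lemma quantile_transform:
  fixes M :: "real measure" and a b :: ereal
  assumes "prob_space M" and sets: "sets M = sets (restrict_space borel (einterval a b))"
  obtains T where "T \<in> measurable (restrict_space lborel {0<..<1}) M"
    "distr (restrict_space lborel {0<..<1}) M T = M"
    "\<And>u x. 0 < u \<Longrightarrow> u < 1 \<Longrightarrow> T u \<le> x \<longleftrightarrow> u \<le> measure M {y\<in>einterval a b. y \<le> x}"
proof -
  interpret prob_space M by fact
  let ?I = "einterval a b" and ?U = "restrict_space lborel {0<..<1} :: real measure"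
  have space: "space M = ?I"
    using sets_eq_imp_space_eq[OF sets] by (simp add: space_restrict_space)
  have id[measurable]: "(\<lambda>x. x) \<in> borel_measurable M"
    unfolding measurable_cong_sets[OF sets refl] by (intro measurable_restrict_space1) simp
  have setsM: "A \<in> sets M \<longleftrightarrow> A \<in> sets borel \<and> A \<subseteq> ?I" for A
    unfolding sets by (subst sets_restrict_space_iff) auto
  define M' where "M' = distr M borel (\<lambda>x. x)"
  interpret M': real_distribution M'
    unfolding M'_def by (rule real_distribution_distr) simp
  interpret M': cdf_distribution M' ..
  have cdf: "cdf M' x = measure M {y\<in>?I. y \<le> x}" for x
    unfolding cdf_def M'_def by (subst measure_distr) (auto simp: space intro!: arg_cong[where f="measure M"])
  let ?T = "M'.I"
  have T: "?T u \<le> x \<longleftrightarrow> u \<le> measure M {y\<in>?I. y \<le> x}" if "0 < u" "u < 1" for u x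
    using M'.pseudoinverse[OF that, of x] cdf by simp
  \<comment> \<open>At a finite left end the distribution function vanishes and u > 0. At a finite
    right end it tends to 1 from the left and u < 1.\<close>
  have TI: "?T u \<in> ?I" if u: "u \<in> {0<..<1}" for u
    unfolding einterval_iff
  proof
    show "a < ereal (?T u)"
    proof (cases a)
      case (real r)
      have "{y\<in>?I. y \<le> r} = {}" using real by (auto simp: einterval_iff)
      then have "measure M {y\<in>?I. y \<le> r} = 0" by (simp only: measure_empty)
      then have "\<not> ?T u \<le> r" using T[of u r] u by auto
      then show ?thesis using real by simp
    next
      case PInf
      then have "space M = {}" using space by (auto simp: einterval_iff)
      then show ?thesis using not_empty by simp
    qed simp
    show "ereal (?T u) < b"
    proof (cases b)
      case (real r)
      \<comment> \<open>Staying 1/(n+1) away from r is what gives T u < r; the fact that M has no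
        mass beyond r would give only T u \<le> r.\<close>
      define A where "A n = {y\<in>?I. y \<le> r - inverse (real (Suc n))}" for n
      have A: "range A \<subseteq> sets M" by (auto simp: A_def setsM)
      have "incseq A"
      proof (rule incseq_SucI, rule subsetI)
        fix n y assume "y \<in> A n"
        moreover have "inverse (real (Suc (Suc n))) \<le> inverse (real (Suc n))"
          by (rule le_imp_inverse_le) auto
        ultimately show "y \<in> A (Suc n)" unfolding A_def mem_Collect_eq by linarith
      qed
      have "(\<Union>n. A n) = space M"
      proof safe
        fix y assume "y \<in> space M"
        then have "y \<in> ?I" "0 < r - y" using space real by (auto simp: einterval_iff)
        then obtain n where "inverse (real (Suc n)) < r - y" using reals_Archimedean by blast
        then show "y \<in> (\<Union>n. A n)" using \<open>y \<in> ?I\<close> by (auto simp: A_def intro!: exI[of _ n])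
      qed (auto simp: A_def space)
      with finite_Lim_measure_incseq[OF A \<open>incseq A\<close>]
      have "(\<lambda>n. measure M (A n)) \<longlonglongrightarrow> 1" by (simp add: prob_space)
      then have "eventually (\<lambda>n. u < measure M (A n)) sequentially"
        using u by (auto intro: order_tendstoD)
      then obtain n where "u < measure M (A n)" by (auto simp: eventually_sequentially)
      then have "?T u \<le> r - inverse (real (Suc n))"
        using T[of u "r - inverse (real (Suc n))"] u by (simp add: A_def)
      moreover have "inverse (real (Suc n)) > 0" by simp
      ultimately have "?T u < r" by linarith
      then show ?thesis using real by simp
    next
      case MInf
      then have "space M = {}" using space by (auto simp: einterval_iff)
      then show ?thesis using not_empty by simp
    qed simp
  qed
  have mT: "?T \<in> borel_measurable ?U"
    using M'.measurable_CI by (simp cong: measurable_cong_sets)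
  have mTM: "?T \<in> measurable ?U M"
  proof (rule measurableI)
    show "?T u \<in> space M" if "u \<in> space ?U" for u
      using TI that by (simp add: space space_restrict_space)
    show "?T -` A \<inter> space ?U \<in> sets ?U" if "A \<in> sets M" for A
      using measurable_sets[OF mT, of A] that by (simp add: setsM)
  qed
  have "distr ?U M ?T = M"
  proof (rule measure_eqI)
    fix A assume "A \<in> sets (distr ?U M ?T)"
    then have A: "A \<in> sets borel" "A \<subseteq> ?I" "A \<in> sets M" by (auto simp: setsM)
    have "emeasure (distr ?U M ?T) A = emeasure (distr ?U borel ?T) A"
      using A mT mTM by (simp add: emeasure_distr)
    also have "distr ?U borel ?T = M'" by (rule M'.distr_I_eq_M)
    also have "emeasure M' A = emeasure M A"
      unfolding M'_def using A space by (subst emeasure_distr) (auto intro!: arg_cong[where f="emeasure M"])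
    finally show "emeasure (distr ?U M ?T) A = emeasure M A" .
  qed simp
  with mTM T show thesis using that by blast
qed

lemma emeasure_lborel_abs_diff:
  assumes "0 \<le> p" "p \<le> 1" "0 \<le> q" "q \<le> (1::real)"
  shows "emeasure lborel {u\<in>{0<..<1}. (u \<le> p) \<noteq> (u \<le> q)} \<le> ennreal \<bar>p - q\<bar>"
proof -
  have "emeasure lborel {u\<in>{0<..<1}. (u \<le> p) \<noteq> (u \<le> q)} \<le> emeasure lborel {min p q..max p q}"
    by (rule emeasure_mono) auto
  also have "\<dots> = ennreal \<bar>p - q\<bar>" by (simp add: max_def min_def abs_real_def)
  finally show ?thesis .
qed

text \<open>Both measures are generated from the same uniform variable u. The distance of the images
  is the integral of r over the points t that separate \<open>S u\<close> from \<open>T u\<close>.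
  After exchanging the integrals, the u separated at t are those between the two values of the
  distribution functions, a set of length at most their difference.\<close>

lemma wasserstein1_metric_of_le:
  fixes M N :: "real measure" and a b :: ereal and \<rho> r :: "real \<Rightarrow> real"
  assumes M: "prob_space M" "sets M = sets (restrict_space borel (einterval a b))"
    and N: "prob_space N" "sets N = sets (restrict_space borel (einterval a b))"
    and \<rho>: "\<rho> \<in> borel_measurable (restrict_space borel (einterval a b))"
    and r: "r \<in> borel_measurable borel"
    and FTC: "\<And>x y. x \<in> einterval a b \<Longrightarrow> y \<in> einterval a b \<Longrightarrow> x \<le> y \<Longrightarrow>
      ennreal \<bar>\<rho> y - \<rho> x\<bar> = (\<integral>\<^sup>+t\<in>{x..<y}. ennreal (r t) \<partial>lborel)"
  shows "wasserstein1 (metric_of \<rho>) M N \<le>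
    (\<integral>\<^sup>+t\<in>einterval a b. ennreal (r t) *
       ennreal \<bar>measure M {y\<in>einterval a b. y \<le> t} - measure N {y\<in>einterval a b. y \<le> t}\<bar> \<partial>lborel)"
proof -
  let ?I = "einterval a b" and ?U = "restrict_space lborel {0<..<1} :: real measure"
  interpret M: prob_space M by fact
  interpret N: prob_space N by fact
  interpret U: prob_space ?U
    by (auto simp: emeasure_restrict_space space_restrict_space intro!: prob_spaceI)
  have space: "space M = ?I" "space N = ?I"
    using sets_eq_imp_space_eq[OF M(2)] sets_eq_imp_space_eq[OF N(2)] by (simp_all add: space_restrict_space)
  define F where "F t = measure M {y\<in>?I. y \<le> t}" for t
  define G where "G t = measure N {y\<in>?I. y \<le> t}" for t
  obtain S where S: "S \<in> measurable ?U M" "distr ?U M S = M"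
    "\<And>u x. 0 < u \<Longrightarrow> u < 1 \<Longrightarrow> S u \<le> x \<longleftrightarrow> u \<le> F x"
    using quantile_transform[OF M] unfolding F_def by blast
  obtain T where T: "T \<in> measurable ?U N" "distr ?U N T = N"
    "\<And>u x. 0 < u \<Longrightarrow> u < 1 \<Longrightarrow> T u \<le> x \<longleftrightarrow> u \<le> G x"
    using quantile_transform[OF N] unfolding G_def by blast
  note [measurable] = S(1) T(1) r
  have \<rho>M: "\<rho> \<in> borel_measurable M" and \<rho>N: "\<rho> \<in> borel_measurable N"
    using \<rho> measurable_cong_sets[OF M(2) refl] measurable_cong_sets[OF N(2) refl] by blast+
  note [measurable] = \<rho>M \<rho>N
  have SI: "S u \<in> ?I" and TI: "T u \<in> ?I" if "u \<in> {0<..<1}" for u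
    using measurable_space[OF S(1), of u] measurable_space[OF T(1), of u] that space
    by (simp_all add: space_restrict_space)
  have idM: "(\<lambda>x. x) \<in> borel_measurable M" "(\<lambda>x. x) \<in> borel_measurable N"
    unfolding measurable_cong_sets[OF M(2) refl] measurable_cong_sets[OF N(2) refl]
    by (intro measurable_restrict_space1; simp)+
  have Sb[measurable]: "S \<in> borel_measurable ?U" "T \<in> borel_measurable ?U"
    using measurable_compose[OF S(1) idM(1)] measurable_compose[OF T(1) idM(2)] by simp_all
  let ?P = "distr ?U (M \<Otimes>\<^sub>M N) (\<lambda>u. (S u, T u))"
  have "?P \<in> couplings M N"
    unfolding couplings_def by (auto simp: distr_distr comp_def S(2) T(2))
  then have "wasserstein1 (metric_of \<rho>) M N \<le> (\<integral>\<^sup>+p. ennreal (metric_of \<rho> (fst p) (snd p)) \<partial>?P)"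
    unfolding wasserstein1_def by (rule INF_lower)
  also have "\<dots> = (\<integral>\<^sup>+u. ennreal \<bar>\<rho> (S u) - \<rho> (T u)\<bar> \<partial>?U)"
    unfolding metric_of_def by (subst nn_integral_distr) auto
  also have "\<dots> = (\<integral>\<^sup>+u. \<integral>\<^sup>+t. ennreal (r t) * indicator {t\<in>?I. (S u \<le> t) \<noteq> (T u \<le> t)} t \<partial>lborel \<partial>?U)"
  proof (rule nn_integral_cong)
    fix u assume "u \<in> space ?U"
    then have u: "u \<in> {0<..<1}" by (simp add: space_restrict_space)
    \<comment> \<open>The comparisons with t differ precisely on the half-open interval, which is
      why \<open>FTC\<close> is stated with {x..<y}.\<close>
    have *: "{t\<in>?I. (S u \<le> t) \<noteq> (T u \<le> t)} = {min (S u) (T u)..<max (S u) (T u)}"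
    proof safe
      fix t assume "t \<in> {min (S u) (T u)..<max (S u) (T u)}"
      then show "t \<in> ?I"
        using einterval_Icc_subset[OF SI[OF u] TI[OF u]] einterval_Icc_subset[OF TI[OF u] SI[OF u]]
        by (auto simp: min_def max_def subset_iff split: if_splits)
    qed auto
    have "ennreal \<bar>\<rho> (S u) - \<rho> (T u)\<bar> =
        ennreal \<bar>\<rho> (max (S u) (T u)) - \<rho> (min (S u) (T u))\<bar>"
      by (auto simp: max_def min_def)
    also have "\<dots> = (\<integral>\<^sup>+t. ennreal (r t) * indicator {min (S u) (T u)..<max (S u) (T u)} t \<partial>lborel)"
      using SI[OF u] TI[OF u] by (intro FTC) (auto simp: min_def max_def)
    finally show "ennreal \<bar>\<rho> (S u) - \<rho> (T u)\<bar> =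
        (\<integral>\<^sup>+t. ennreal (r t) * indicator {t\<in>?I. (S u \<le> t) \<noteq> (T u \<le> t)} t \<partial>lborel)"
      unfolding * .
  qed
  also have "\<dots> = (\<integral>\<^sup>+t. \<integral>\<^sup>+u. ennreal (r t) * indicator {t\<in>?I. (S u \<le> t) \<noteq> (T u \<le> t)} t \<partial>?U \<partial>lborel)"
  proof (rule pair_sigma_finite.Fubini')
    show "pair_sigma_finite lborel ?U"
      by (intro pair_sigma_finite.intro sigma_finite_lborel U.sigma_finite_measure_axioms)
    \<comment> \<open>The set in the indicator depends on u; as a condition on the pair its joint
      measurability is visible.\<close>
    have "(\<lambda>(t, u). ennreal (r t) * indicator {t\<in>?I. (S u \<le> t) \<noteq> (T u \<le> t)} t)
        = (\<lambda>p. ennreal (r (fst p)) *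
            (if fst p \<in> ?I \<and> (S (snd p) \<le> fst p) \<noteq> (T (snd p) \<le> fst p) then 1 else 0))"
      by (auto simp: indicator_def)
    also have "\<dots> \<in> borel_measurable (lborel \<Otimes>\<^sub>M ?U)" by measurable
    finally show "(\<lambda>(t, u). ennreal (r t) * indicator {t\<in>?I. (S u \<le> t) \<noteq> (T u \<le> t)} t)
        \<in> borel_measurable (lborel \<Otimes>\<^sub>M ?U)" .
  qed
  also have "\<dots> \<le> (\<integral>\<^sup>+t\<in>?I. ennreal (r t) * ennreal \<bar>F t - G t\<bar> \<partial>lborel)"
  proof (rule nn_integral_mono)
    fix t
    let ?A = "{u\<in>{0<..<1}. (u \<le> F t) \<noteq> (u \<le> G t)}"
    have A: "?A \<in> sets borel" by measurable
    have "(\<integral>\<^sup>+u. ennreal (r t) * indicator {t\<in>?I. (S u \<le> t) \<noteq> (T u \<le> t)} t \<partial>?U)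
        = (\<integral>\<^sup>+u. (ennreal (r t) * indicator ?I t) * indicator ?A u \<partial>?U)"
      by (rule nn_integral_cong) (auto simp: space_restrict_space S(3) T(3) indicator_def)
    also have "\<dots> = ennreal (r t) * indicator ?I t * emeasure ?U ?A"
      using A by (intro nn_integral_cmult_indicator) (auto simp: sets_restrict_space_iff)
    also have "emeasure ?U ?A = emeasure lborel ?A"
      by (subst emeasure_restrict_space) auto
    also have "ennreal (r t) * indicator ?I t * emeasure lborel ?A
        \<le> ennreal (r t) * indicator ?I t * ennreal \<bar>F t - G t\<bar>"
      by (intro mult_left_mono emeasure_lborel_abs_diff) (auto simp: F_def G_def)
    also have "\<dots> = ennreal (r t) * ennreal \<bar>F t - G t\<bar> * indicator ?I t"
      by (simp only: ac_simps)
    finally show "(\<integral>\<^sup>+u. ennreal (r t) * indicator {t\<in>?I. (S u \<le> t) \<noteq> (T u \<le> t)} t \<partial>?U)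
        \<le> ennreal (r t) * ennreal \<bar>F t - G t\<bar> * indicator ?I t" .
  qed
  finally show ?thesis unfolding F_def G_def .
qed

section \<open>Transport cost of a density\<close>

text \<open>With p and q the masses of {y \<le> x} under \<mu> and the density, q - p = q (1 - p) -
  p (1 - q). Both products are integrals over the same set of pairs y \<le> x < z, the first of f(y)
  and the second of f(z).\<close>

lemma cdf_diff_le:
  fixes \<mu> :: "real measure" and f :: "real \<Rightarrow> real"
  assumes \<mu>: "prob_space \<mu>" "sets \<mu> = sets (restrict_space borel S)"
    and f: "f \<in> borel_measurable \<mu>" "\<And>x. x \<in> S \<Longrightarrow> 0 \<le> f x"
    and \<nu>: "prob_space (density \<mu> (\<lambda>x. ennreal (f x)))"
  shows "ennreal \<bar>measure (density \<mu> (\<lambda>x. ennreal (f x))) {y\<in>S. y \<le> x} - measure \<mu> {y\<in>S. y \<le> x}\<bar>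
    \<le> (\<integral>\<^sup>+p. (if fst p \<le> x \<and> x < snd p then ennreal \<bar>f (snd p) - f (fst p)\<bar> else 0) \<partial>(\<mu> \<Otimes>\<^sub>M \<mu>))"
    (is "_ \<le> ?K")
proof -
  interpret prob_space \<mu> by fact
  let ?\<nu> = "density \<mu> (\<lambda>x. ennreal (f x))"
  interpret \<nu>: prob_space ?\<nu> by fact
  have space: "space \<mu> = S"
    using sets_eq_imp_space_eq[OF \<mu>(2)] by (simp add: space_restrict_space)
  have id[measurable]: "(\<lambda>x. x) \<in> borel_measurable \<mu>"
    unfolding measurable_cong_sets[OF \<mu>(2) refl] by (intro measurable_restrict_space1) simp
  note f(1)[measurable]
  let ?L = "{y\<in>S. y \<le> x}" and ?R = "{y\<in>S. x < y}"
  have "{y\<in>space \<mu>. y \<le> x} \<in> sets \<mu>" "{y\<in>space \<mu>. x < y} \<in> sets \<mu>" by measurable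
  then have LR[measurable]: "?L \<in> sets \<mu>" "?R \<in> sets \<mu>" by (simp_all add: space)
  define p where "p = measure \<mu> ?L"
  define q where "q = measure ?\<nu> ?L"
  have R: "measure \<mu> ?R = 1 - p" "measure ?\<nu> ?R = 1 - q"
    using prob_compl[OF LR(1)] \<nu>.prob_compl[of ?L] LR(1) unfolding p_def q_def space space_density
    by (simp_all add: set_diff_eq not_le conj_commute cong: conj_cong)
  have pq: "0 \<le> p" "p \<le> 1" "0 \<le> q" "q \<le> 1" by (simp_all add: p_def q_def)
  have \<mu>L: "(\<integral>\<^sup>+y. indicator ?L y \<partial>\<mu>) = ennreal p" "(\<integral>\<^sup>+y. indicator ?R y \<partial>\<mu>) = ennreal (1 - p)"
    using R by (simp_all add: p_def emeasure_eq_measure)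
  have \<nu>L: "(\<integral>\<^sup>+y. ennreal (f y) * indicator ?L y \<partial>\<mu>) = ennreal q"
    "(\<integral>\<^sup>+y. ennreal (f y) * indicator ?R y \<partial>\<mu>) = ennreal (1 - q)"
    using R \<nu>.emeasure_eq_measure LR by (simp_all add: q_def emeasure_density[symmetric])
  have prod: "(\<integral>\<^sup>+p. u (fst p) * v (snd p) \<partial>(\<mu> \<Otimes>\<^sub>M \<mu>)) = (\<integral>\<^sup>+y. u y \<partial>\<mu>) * (\<integral>\<^sup>+z. v z \<partial>\<mu>)"
    if [measurable]: "u \<in> borel_measurable \<mu>" "v \<in> borel_measurable \<mu>" for u v :: "real \<Rightarrow> ennreal"
    by (subst nn_integral_fst[symmetric]) (simp_all add: nn_integral_cmult nn_integral_multc)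
  \<comment> \<open>Subtraction in \<open>ennreal\<close> truncates, so the two signs are treated as
    separate additive inequalities.\<close>
  have 1: "ennreal (p * (1 - q)) \<le> ennreal (q * (1 - p)) + ?K"
  proof -
    have "ennreal (p * (1 - q)) = ennreal p * ennreal (1 - q)"
      using pq by (simp add: ennreal_mult)
    also have "\<dots> = (\<integral>\<^sup>+p. indicator ?L (fst p) * (ennreal (f (snd p)) * indicator ?R (snd p)) \<partial>(\<mu> \<Otimes>\<^sub>M \<mu>))"
      unfolding \<mu>L(1)[symmetric] \<nu>L(2)[symmetric] by (rule prod[symmetric]) measurable
    also have "\<dots> \<le> (\<integral>\<^sup>+p. (ennreal (f (fst p)) * indicator ?L (fst p)) * indicator ?R (snd p) +
        (if fst p \<le> x \<and> x < snd p then ennreal \<bar>f (snd p) - f (fst p)\<bar> else 0) \<partial>(\<mu> \<Otimes>\<^sub>M \<mu>))"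
      by (rule nn_integral_mono)
        (auto simp: indicator_def space_pair_measure space f(2) ennreal_plus[symmetric] simp del: ennreal_plus intro!: ennreal_leI)
    also have "\<dots> = (\<integral>\<^sup>+p. (ennreal (f (fst p)) * indicator ?L (fst p)) * indicator ?R (snd p) \<partial>(\<mu> \<Otimes>\<^sub>M \<mu>)) + ?K"
      by (rule nn_integral_add) measurable
    also have "(\<integral>\<^sup>+p. (ennreal (f (fst p)) * indicator ?L (fst p)) * indicator ?R (snd p) \<partial>(\<mu> \<Otimes>\<^sub>M \<mu>))
        = ennreal q * ennreal (1 - p)"
      unfolding \<mu>L(2)[symmetric] \<nu>L(1)[symmetric] by (rule prod) measurable
    also have "\<dots> = ennreal (q * (1 - p))"
      using pq by (simp add: ennreal_mult)
    finally show ?thesis .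
  qed
  have 2: "ennreal (q * (1 - p)) \<le> ennreal (p * (1 - q)) + ?K"
  proof -
    have "ennreal (q * (1 - p)) = ennreal q * ennreal (1 - p)"
      using pq by (simp add: ennreal_mult)
    also have "\<dots> = (\<integral>\<^sup>+p. (ennreal (f (fst p)) * indicator ?L (fst p)) * indicator ?R (snd p) \<partial>(\<mu> \<Otimes>\<^sub>M \<mu>))"
      unfolding \<mu>L(2)[symmetric] \<nu>L(1)[symmetric] by (rule prod[symmetric]) measurable
    also have "\<dots> \<le> (\<integral>\<^sup>+p. indicator ?L (fst p) * (ennreal (f (snd p)) * indicator ?R (snd p)) +
        (if fst p \<le> x \<and> x < snd p then ennreal \<bar>f (snd p) - f (fst p)\<bar> else 0) \<partial>(\<mu> \<Otimes>\<^sub>M \<mu>))"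
      by (rule nn_integral_mono)
        (auto simp: indicator_def space_pair_measure space f(2) ennreal_plus[symmetric] simp del: ennreal_plus intro!: ennreal_leI)
    also have "\<dots> = (\<integral>\<^sup>+p. indicator ?L (fst p) * (ennreal (f (snd p)) * indicator ?R (snd p)) \<partial>(\<mu> \<Otimes>\<^sub>M \<mu>)) + ?K"
      by (rule nn_integral_add) measurable
    also have "(\<integral>\<^sup>+p. indicator ?L (fst p) * (ennreal (f (snd p)) * indicator ?R (snd p)) \<partial>(\<mu> \<Otimes>\<^sub>M \<mu>))
        = ennreal p * ennreal (1 - q)"
      unfolding \<mu>L(1)[symmetric] \<nu>L(2)[symmetric] by (rule prod) measurable
    also have "\<dots> = ennreal (p * (1 - q))"
      using pq by (simp add: ennreal_mult)
    finally show ?thesis .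
  qed
  have "ennreal \<bar>q - p\<bar> \<le> ?K"
  \<comment> \<open>The inequalities can be subtracted in the reals once \<open>?K\<close> is
    finite; an infinite \<open>?K\<close> bounds everything.\<close>
  proof (cases ?K)
    case (real k)
    with 1 2 pq have "p * (1 - q) \<le> q * (1 - p) + k" "q * (1 - p) \<le> p * (1 - q) + k"
      by (simp_all add: ennreal_plus[symmetric] del: ennreal_plus)
    then have "\<bar>q - p\<bar> \<le> k" by (simp add: algebra_simps)
    then show ?thesis unfolding real by (rule ennreal_leI)
  qed simp
  then show ?thesis by (simp add: p_def q_def)
qed

text \<open>Two applications of Tonelli's theorem. There are three variables: the point x at which
  distribution functions are compared, the pair p, and the point t at which the derivative of h^2 is
  taken.\<close>

lemma wasserstein1_density_le:
  fixes \<mu> :: "real measure" and a b :: ereal and \<rho> r h g :: "real \<Rightarrow> real"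
  assumes \<mu>: "prob_space \<mu>" "sets \<mu> = sets (restrict_space borel (einterval a b))"
    and \<nu>: "prob_space (density \<mu> (\<lambda>x. ennreal ((h x)\<^sup>2)))"
    and \<rho>: "\<rho> \<in> borel_measurable (restrict_space borel (einterval a b))"
    and r: "r \<in> borel_measurable borel"
    and FTC: "\<And>x y. x \<in> einterval a b \<Longrightarrow> y \<in> einterval a b \<Longrightarrow> x \<le> y \<Longrightarrow>
      ennreal \<bar>\<rho> y - \<rho> x\<bar> = (\<integral>\<^sup>+t\<in>{x..<y}. ennreal (r t) \<partial>lborel)"
    and h: "locally_abs_cont_on (einterval a b) h"
    and g: "g \<in> borel_measurable borel"
      "AE x in lborel. x \<in> einterval a b \<longrightarrow> (h has_real_derivative g x) (at x)"
  shows "wasserstein1 (metric_of \<rho>) (density \<mu> (\<lambda>x. ennreal ((h x)\<^sup>2))) \<mu> \<le>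
    (\<integral>\<^sup>+t\<in>einterval a b. ennreal (2 * \<bar>h t\<bar> * \<bar>g t\<bar>) *
       (\<integral>\<^sup>+p. (if fst p \<le> t \<and> t \<le> snd p then ennreal \<bar>\<rho> (snd p) - \<rho> (fst p)\<bar> else 0) \<partial>(\<mu> \<Otimes>\<^sub>M \<mu>)) \<partial>lborel)"
proof -
  let ?I = "einterval a b" and ?\<nu> = "density \<mu> (\<lambda>x. ennreal ((h x)\<^sup>2))" and ?P = "\<mu> \<Otimes>\<^sub>M \<mu>"
  interpret prob_space \<mu> by fact
  interpret \<nu>: prob_space ?\<nu> by fact
  interpret PP: pair_prob_space \<mu> \<mu> ..
  interpret Q: pair_sigma_finite ?P lborel
    by (intro pair_sigma_finite.intro PP.sigma_finite_measure_axioms sigma_finite_lborel)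
  have space: "space \<mu> = ?I"
    using sets_eq_imp_space_eq[OF \<mu>(2)] by (simp add: space_restrict_space)
  have id: "(\<lambda>x. x) \<in> borel_measurable \<mu>"
    unfolding measurable_cong_sets[OF \<mu>(2) refl] by (intro measurable_restrict_space1) simp
  have cont: "continuous_on ?I h" by (rule locally_abs_cont_on_imp_continuous_on[OF h])
  have mh[measurable]: "h \<in> borel_measurable \<mu>"
    unfolding measurable_cong_sets[OF \<mu>(2) refl] by (rule borel_measurable_continuous_on_restrict[OF cont])
  have m\<rho>[measurable]: "\<rho> \<in> borel_measurable \<mu>"
    unfolding measurable_cong_sets[OF \<mu>(2) refl] by (rule \<rho>)
  note r[measurable] g(1)[measurable]
  \<comment> \<open>Cutting h off outside the interval makes the integrand Borel on the whole line,
    as products with \<open>lborel\<close> require.\<close>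
  define k where "k t = ennreal (2 * \<bar>if t \<in> ?I then h t else 0\<bar> * \<bar>g t\<bar>)" for t
  have "(\<lambda>t. if t \<in> ?I then h t else 0) \<in> borel_measurable borel"
    by (rule borel_measurable_continuous_on_if) (use cont in auto)
  then have k[measurable]: "k \<in> borel_measurable borel" unfolding k_def by measurable
  have kI: "k t = ennreal (2 * \<bar>h t\<bar> * \<bar>g t\<bar>) * indicator ?I t" for t
    by (simp add: k_def)
  define W where "W p = (\<integral>\<^sup>+t. k t * (if fst p \<le> t \<and> t \<le> snd p then 1 else 0) \<partial>lborel)" for p :: "real \<times> real"
  have fst_snd[measurable]: "(\<lambda>p. fst p) \<in> borel_measurable ?P" "(\<lambda>p. snd p) \<in> borel_measurable ?P"
    by (rule measurable_compose[OF measurable_fst id], rule measurable_compose[OF measurable_snd id])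
  have W[measurable]: "W \<in> borel_measurable ?P"
    unfolding W_def by measurable
  have hW: "ennreal \<bar>(h (snd p))\<^sup>2 - (h (fst p))\<^sup>2\<bar> \<le> W p" if "p \<in> space ?P" "fst p \<le> snd p" for p
  proof -
    have p: "fst p \<in> ?I" "snd p \<in> ?I" using that by (auto simp: space_pair_measure space)
    have "ennreal \<bar>(h (snd p))\<^sup>2 - (h (fst p))\<^sup>2\<bar> \<le> (\<integral>\<^sup>+t\<in>{fst p..snd p}. ennreal (2 * \<bar>h t\<bar> * \<bar>g t\<bar>) \<partial>lborel)"
      by (rule power2_increment_le_nn_integral[OF h g(2) p that(2)])
    also have "\<dots> = W p"
      unfolding W_def
      by (rule nn_integral_cong) (use subsetD[OF einterval_Icc_subset[OF p]] in \<open>auto simp: kI indicator_def\<close>)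
    finally show ?thesis .
  qed
  have "wasserstein1 (metric_of \<rho>) ?\<nu> \<mu> \<le>
    (\<integral>\<^sup>+x\<in>?I. ennreal (r x) * ennreal \<bar>measure ?\<nu> {y\<in>?I. y \<le> x} - measure \<mu> {y\<in>?I. y \<le> x}\<bar> \<partial>lborel)"
    by (rule wasserstein1_metric_of_le) (use assms in simp_all)
  also have "\<dots> \<le> (\<integral>\<^sup>+x. ennreal (r x) * indicator ?I x *
      (\<integral>\<^sup>+p. (if fst p \<le> x \<and> x < snd p then 1 else 0) * W p \<partial>?P) \<partial>lborel)"
  proof (rule nn_integral_mono)
    fix x
    have "ennreal \<bar>measure ?\<nu> {y\<in>?I. y \<le> x} - measure \<mu> {y\<in>?I. y \<le> x}\<bar>
        \<le> (\<integral>\<^sup>+p. (if fst p \<le> x \<and> x < snd p then ennreal \<bar>(h (snd p))\<^sup>2 - (h (fst p))\<^sup>2\<bar> else 0) \<partial>?P)"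
      by (rule cdf_diff_le) (use \<mu> \<nu> in simp_all)
    also have "\<dots> \<le> (\<integral>\<^sup>+p. (if fst p \<le> x \<and> x < snd p then 1 else 0) * W p \<partial>?P)"
      by (rule nn_integral_mono) (use hW in auto)
    finally have "ennreal (r x) * indicator ?I x * ennreal \<bar>measure ?\<nu> {y\<in>?I. y \<le> x} - measure \<mu> {y\<in>?I. y \<le> x}\<bar>
        \<le> ennreal (r x) * indicator ?I x * (\<integral>\<^sup>+p. (if fst p \<le> x \<and> x < snd p then 1 else 0) * W p \<partial>?P)"
      by (intro mult_left_mono) auto
    then show "ennreal (r x) * ennreal \<bar>measure ?\<nu> {y\<in>?I. y \<le> x} - measure \<mu> {y\<in>?I. y \<le> x}\<bar> * indicator ?I x
        \<le> ennreal (r x) * indicator ?I x * (\<integral>\<^sup>+p. (if fst p \<le> x \<and> x < snd p then 1 else 0) * W p \<partial>?P)"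
      by (simp only: ac_simps)
  qed
  also have "\<dots> = (\<integral>\<^sup>+x. \<integral>\<^sup>+p. ennreal (r x) * indicator ?I x *
      ((if fst p \<le> x \<and> x < snd p then 1 else 0) * W p) \<partial>?P \<partial>lborel)"
    by (intro nn_integral_cong nn_integral_cmult[symmetric]) measurable
  \<comment> \<open>With p fixed, \<open>W p\<close> is constant in x, and the integral of r over x
    rebuilds the increment of \<rho> across the pair.\<close>
  also have "\<dots> = (\<integral>\<^sup>+p. \<integral>\<^sup>+x. ennreal (r x) * indicator ?I x *
      ((if fst p \<le> x \<and> x < snd p then 1 else 0) * W p) \<partial>lborel \<partial>?P)"
    by (rule Q.Fubini'[symmetric, THEN sym]) measurable
  also have "\<dots> = (\<integral>\<^sup>+p. (if fst p \<le> snd p then ennreal \<bar>\<rho> (snd p) - \<rho> (fst p)\<bar> else 0) * W p \<partial>?P)"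
  proof (rule nn_integral_cong)
    fix p assume "p \<in> space ?P"
    then have p: "fst p \<in> ?I" "snd p \<in> ?I" by (auto simp: space_pair_measure space)
    have "(\<integral>\<^sup>+x. ennreal (r x) * indicator ?I x * ((if fst p \<le> x \<and> x < snd p then 1 else 0) * W p) \<partial>lborel)
        = (\<integral>\<^sup>+x. (ennreal (r x) * indicator {fst p..<snd p} x) * W p \<partial>lborel)"
      by (rule nn_integral_cong)
        (use subsetD[OF einterval_Icc_subset[OF p]] in \<open>auto simp: indicator_def\<close>)
    also have "\<dots> = (\<integral>\<^sup>+x\<in>{fst p..<snd p}. ennreal (r x) \<partial>lborel) * W p"
      by (rule nn_integral_multc)
        (auto intro!: borel_measurable_times_ennreal measurable_compose[OF r] borel_measurable_indicator)
    also have "\<dots> = (if fst p \<le> snd p then ennreal \<bar>\<rho> (snd p) - \<rho> (fst p)\<bar> else 0) * W p"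
      using FTC[OF p] by auto
    finally show "(\<integral>\<^sup>+x. ennreal (r x) * indicator ?I x * ((if fst p \<le> x \<and> x < snd p then 1 else 0) * W p) \<partial>lborel)
      = (if fst p \<le> snd p then ennreal \<bar>\<rho> (snd p) - \<rho> (fst p)\<bar> else 0) * W p" .
  qed
  also have "\<dots> = (\<integral>\<^sup>+p. \<integral>\<^sup>+t. k t *
      (if fst p \<le> t \<and> t \<le> snd p then ennreal \<bar>\<rho> (snd p) - \<rho> (fst p)\<bar> else 0) \<partial>lborel \<partial>?P)"
  proof (rule nn_integral_cong)
    fix p
    have "(if fst p \<le> snd p then ennreal \<bar>\<rho> (snd p) - \<rho> (fst p)\<bar> else 0) * W p
      = (\<integral>\<^sup>+t. (if fst p \<le> snd p then ennreal \<bar>\<rho> (snd p) - \<rho> (fst p)\<bar> else 0) *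
          (k t * (if fst p \<le> t \<and> t \<le> snd p then 1 else 0)) \<partial>lborel)"
      unfolding W_def by (rule nn_integral_cmult[symmetric]) measurable
    also have "\<dots> = (\<integral>\<^sup>+t. k t *
      (if fst p \<le> t \<and> t \<le> snd p then ennreal \<bar>\<rho> (snd p) - \<rho> (fst p)\<bar> else 0) \<partial>lborel)"
      by (rule nn_integral_cong) (auto simp: mult.commute)
    finally show "(if fst p \<le> snd p then ennreal \<bar>\<rho> (snd p) - \<rho> (fst p)\<bar> else 0) * W p = \<dots>" .
  qed
  \<comment> \<open>Second exchange: with t outside, the inner integral over pairs involves only
    \<rho> and \<mu>, and all dependence on h is in the factor \<open>k t\<close>.\<close>
  also have "\<dots> = (\<integral>\<^sup>+t. \<integral>\<^sup>+p. k t *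
      (if fst p \<le> t \<and> t \<le> snd p then ennreal \<bar>\<rho> (snd p) - \<rho> (fst p)\<bar> else 0) \<partial>?P \<partial>lborel)"
    by (rule Q.Fubini'[symmetric]) measurable
  also have "\<dots> = (\<integral>\<^sup>+t\<in>?I. ennreal (2 * \<bar>h t\<bar> * \<bar>g t\<bar>) *
      (\<integral>\<^sup>+p. (if fst p \<le> t \<and> t \<le> snd p then ennreal \<bar>\<rho> (snd p) - \<rho> (fst p)\<bar> else 0) \<partial>?P) \<partial>lborel)"
  proof (rule nn_integral_cong)
    fix t
    have "(\<integral>\<^sup>+p. k t * (if fst p \<le> t \<and> t \<le> snd p then ennreal \<bar>\<rho> (snd p) - \<rho> (fst p)\<bar> else 0) \<partial>?P)
      = k t * (\<integral>\<^sup>+p. (if fst p \<le> t \<and> t \<le> snd p then ennreal \<bar>\<rho> (snd p) - \<rho> (fst p)\<bar> else 0) \<partial>?P)"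
      by (rule nn_integral_cmult) measurable
    then show "(\<integral>\<^sup>+p. k t * (if fst p \<le> t \<and> t \<le> snd p then ennreal \<bar>\<rho> (snd p) - \<rho> (fst p)\<bar> else 0) \<partial>?P)
      = ennreal (2 * \<bar>h t\<bar> * \<bar>g t\<bar>) *
        (\<integral>\<^sup>+p. (if fst p \<le> t \<and> t \<le> snd p then ennreal \<bar>\<rho> (snd p) - \<rho> (fst p)\<bar> else 0) \<partial>?P) * indicator ?I t"
      by (simp only: kI ac_simps)
  qed
  finally show ?thesis .
qed

text \<open>With R the indicator of z \<ge> t, q its mean, B the mean of R \<rho> and m the mean of
  \<rho>, the double integral factors into B (1 - q) - q (m - B) = B - m q. This is the covariance
  of R and \<rho>.\<close>

lemma nn_integral_pair_increment:
  fixes \<mu> :: "real measure" and \<rho> :: "real \<Rightarrow> real"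
  assumes \<mu>: "prob_space \<mu>" "sets \<mu> = sets (restrict_space borel S)"
    and \<rho>: "integrable \<mu> \<rho>" "\<And>x y. x \<in> S \<Longrightarrow> y \<in> S \<Longrightarrow> x \<le> y \<Longrightarrow> \<rho> x \<le> \<rho> y"
    and t: "AE x in \<mu>. x \<noteq> t"
  shows "(\<integral>\<^sup>+p. (if fst p \<le> t \<and> t \<le> snd p then ennreal \<bar>\<rho> (snd p) - \<rho> (fst p)\<bar> else 0) \<partial>(\<mu> \<Otimes>\<^sub>M \<mu>))
    = ennreal (LINT z:{t<..}|\<mu>. \<rho> z - (LINT w|\<mu>. \<rho> w))"
proof -
  interpret prob_space \<mu> by fact
  have space: "space \<mu> = S"
    using sets_eq_imp_space_eq[OF \<mu>(2)] by (simp add: space_restrict_space)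
  have id[measurable]: "(\<lambda>x. x) \<in> borel_measurable \<mu>"
    unfolding measurable_cong_sets[OF \<mu>(2) refl] by (intro measurable_restrict_space1) simp
  note borel_measurable_integrable[OF \<rho>(1), measurable]
  define L where "L y = (if y \<le> t then 1 else 0 :: real)" for y
  define R where "R y = (if t \<le> y then 1 else 0 :: real)" for y
  have [measurable]: "L \<in> borel_measurable \<mu>" "R \<in> borel_measurable \<mu>"
    unfolding L_def R_def by measurable
  have int: "integrable \<mu> L" "integrable \<mu> R"
    by (rule integrable_const_bound[of _ 1]; simp add: L_def R_def)+
  have intL: "integrable \<mu> (\<lambda>y. L y * \<rho> y)" "integrable \<mu> (\<lambda>y. R y * \<rho> y)"
    by (rule Bochner_Integration.integrable_bound[OF \<rho>(1)]; simp add: L_def R_def)+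
  \<comment> \<open>Both indicators include t. Since t is no atom they are complementary almost
    everywhere, and the closed half-line may later be exchanged for {t<..}.\<close>
  have LR: "AE y in \<mu>. L y = 1 - R y"
    using t by eventually_elim (auto simp: L_def R_def)
  define q where "q = (LINT y|\<mu>. R y)"
  define B where "B = (LINT y|\<mu>. R y * \<rho> y)"
  define m where "m = (LINT y|\<mu>. \<rho> y)"
  have p: "(LINT y|\<mu>. L y) = 1 - q"
  proof -
    have "(LINT y|\<mu>. L y) = (LINT y|\<mu>. 1 - R y)"
      using LR by (intro integral_cong_AE) auto
    then show ?thesis using int by (simp add: q_def prob_space)
  qed
  have A: "(LINT y|\<mu>. L y * \<rho> y) = m - B"
  proof -
    have "(LINT y|\<mu>. L y * \<rho> y) = (LINT y|\<mu>. \<rho> y - R y * \<rho> y)"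
    proof (rule integral_cong_AE)
      show "AE y in \<mu>. L y * \<rho> y = \<rho> y - R y * \<rho> y"
        using LR by eventually_elim (simp add: left_diff_distrib)
    qed measurable
    then show ?thesis using intL \<rho> by (simp add: m_def B_def)
  qed
  have "(\<integral>\<^sup>+p. (if fst p \<le> t \<and> t \<le> snd p then ennreal \<bar>\<rho> (snd p) - \<rho> (fst p)\<bar> else 0) \<partial>(\<mu> \<Otimes>\<^sub>M \<mu>))
      = (\<integral>\<^sup>+p. ennreal (L (fst p) * R (snd p) * (\<rho> (snd p) - \<rho> (fst p))) \<partial>(\<mu> \<Otimes>\<^sub>M \<mu>))"
    by (rule nn_integral_cong)
      (auto simp: L_def R_def space_pair_measure space abs_of_nonneg \<rho>(2) intro!: arg_cong[where f=ennreal])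
  also have "\<dots> = (\<integral>\<^sup>+y. \<integral>\<^sup>+z. ennreal (L y * R z * (\<rho> z - \<rho> y)) \<partial>\<mu> \<partial>\<mu>)"
    by (subst nn_integral_fst[symmetric]) simp_all
  also have "\<dots> = (\<integral>\<^sup>+y. ennreal (L y * (B - q * \<rho> y)) \<partial>\<mu>)"
  proof (rule nn_integral_cong)
    fix y assume "y \<in> space \<mu>"
    have "(\<integral>\<^sup>+z. ennreal (L y * R z * (\<rho> z - \<rho> y)) \<partial>\<mu>) = ennreal (LINT z|\<mu>. L y * R z * (\<rho> z - \<rho> y))"
    proof (rule nn_integral_eq_integral)
      have "integrable \<mu> (\<lambda>z. L y * (R z * \<rho> z) - L y * \<rho> y * R z)"
        using int intL by auto
      then show "integrable \<mu> (\<lambda>z. L y * R z * (\<rho> z - \<rho> y))" by (simp add: algebra_simps)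
      show "AE z in \<mu>. 0 \<le> L y * R z * (\<rho> z - \<rho> y)"
        using \<open>y \<in> space \<mu>\<close> \<rho>(2) by (intro AE_I2) (auto simp: L_def R_def space)
    qed
    also have "(LINT z|\<mu>. L y * R z * (\<rho> z - \<rho> y)) = (LINT z|\<mu>. L y * (R z * \<rho> z) - L y * \<rho> y * R z)"
      by (simp add: algebra_simps)
    also have "\<dots> = L y * (B - q * \<rho> y)"
      using int intL by (simp add: B_def q_def algebra_simps)
    finally show "(\<integral>\<^sup>+z. ennreal (L y * R z * (\<rho> z - \<rho> y)) \<partial>\<mu>) = ennreal (L y * (B - q * \<rho> y))" .
  qed
  also have "\<dots> = ennreal (LINT y|\<mu>. L y * (B - q * \<rho> y))"
  proof (rule nn_integral_eq_integral)
    have "integrable \<mu> (\<lambda>y. B * L y - q * (L y * \<rho> y))"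
      using int intL by auto
    then show "integrable \<mu> (\<lambda>y. L y * (B - q * \<rho> y))" by (simp add: algebra_simps)
    show "AE y in \<mu>. 0 \<le> L y * (B - q * \<rho> y)"
    proof (rule AE_I2)
      fix y assume "y \<in> space \<mu>"
      have "0 \<le> (LINT z|\<mu>. L y * (R z * \<rho> z - \<rho> y * R z))"
        using \<open>y \<in> space \<mu>\<close> \<rho>(2) by (intro integral_nonneg_AE AE_I2) (auto simp: L_def R_def space)
      then show "0 \<le> L y * (B - q * \<rho> y)" using int intL by (simp add: B_def q_def mult.commute)
    qed
  qed
  also have "(LINT y|\<mu>. L y * (B - q * \<rho> y)) = (LINT y|\<mu>. B * L y - q * (L y * \<rho> y))"
    by (simp add: algebra_simps)
  also have "\<dots> = B * (1 - q) - q * (m - B)"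
    using int intL p A by simp
  also have "\<dots> = B - m * q" by (simp add: algebra_simps)
  also have "\<dots> = (LINT z|\<mu>. R z * \<rho> z - m * R z)"
    using int intL by (simp add: B_def q_def)
  also have "\<dots> = (LINT z:{t<..}|\<mu>. \<rho> z - m)"
    unfolding set_lebesgue_integral_def
  proof (rule integral_cong_AE)
    show "AE z in \<mu>. R z * \<rho> z - m * R z = indicat_real {t<..} z *\<^sub>R (\<rho> z - m)"
      using t by eventually_elim (auto simp: R_def indicator_def)
  qed measurable
  finally show ?thesis by (simp add: m_def)
qed

section \<open>The diffusion\<close>

text \<open>Leaves room on both sides of two points, so that both are interior to a compact
  subinterval on which the fundamental theorem applies.\<close>

lemma einterval_wider:
  assumes "x \<in> einterval a b" "y \<in> einterval a b"
  obtains p q where "p < x" "p < y" "x < q" "y < q" "p \<in> einterval a b" "q \<in> einterval a b"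
proof -
  have *: "\<exists>p q. p < z \<and> z < q \<and> p \<in> einterval a b \<and> q \<in> einterval a b" if z: "z \<in> einterval a b" for z
  proof -
    obtain e where e: "e > 0" "cball z e \<subseteq> einterval a b"
      using open_contains_cball[of "einterval a b"] z by auto
    have "z - e \<in> cball z e" "z + e \<in> cball z e" using e(1) by (simp_all add: dist_real_def)
    then have "z - e \<in> einterval a b" "z + e \<in> einterval a b" using subsetD[OF e(2)] by blast+
    with e(1) show ?thesis by (intro exI[of _ "z - e"] exI[of _ "z + e"]) simp
  qed
  from *[OF assms(1)] *[OF assms(2)] obtain p q p' q' where
    "p < x" "x < q" "p \<in> einterval a b" "q \<in> einterval a b"
    "p' < y" "y < q'" "p' \<in> einterval a b" "q' \<in> einterval a b" by blast
  then show thesis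
    by (intro that[of "min p p'" "max q q'"]) (simp_all add: min_def max_def)
qed

lemma interval_integral_has_real_derivative:
  fixes k :: "real \<Rightarrow> real"
  assumes k: "continuous_on (einterval a b) k" and c: "c \<in> einterval a b" and x: "x \<in> einterval a b"
  shows "((\<lambda>u. LBINT z=ereal c..ereal u. k z) has_real_derivative k x) (at x)"
proof -
  obtain p q where pq: "p < c" "p < x" "c < q" "x < q" "p \<in> einterval a b" "q \<in> einterval a b"
    by (rule einterval_wider[OF c x])
  have "continuous_on {p..q} k"
    by (rule continuous_on_subset[OF k einterval_Icc_subset[OF pq(5,6)]])
  then have "((\<lambda>u. LBINT z=ereal c..ereal u. k z) has_vector_derivative k x) (at x within {p..q})"
    using pq by (intro interval_integral_FTC2) auto
  moreover have "at x within {p..q} = at x"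
    by (rule at_within_interior) (simp add: pq)
  ultimately show ?thesis
    by (simp only: has_real_derivative_iff_has_vector_derivative)
qed

text \<open>Supplies the hypotheses on \<rho> and r in the transport estimate. The derivative is set
  to 0 outside the interval, where \<open>deriv\<close> is not known to be measurable.\<close>

lemma C1_increment_eq_nn_integral:
  fixes \<rho> :: "real \<Rightarrow> real"
  assumes \<rho>: "\<rho> C1_differentiable_on einterval a b" and pos: "\<forall>x\<in>einterval a b. 0 \<le> deriv \<rho> x"
  shows "(\<lambda>x. if x \<in> einterval a b then deriv \<rho> x else 0) \<in> borel_measurable borel"
    and "x \<in> einterval a b \<Longrightarrow> y \<in> einterval a b \<Longrightarrow> x \<le> y \<Longrightarrow> \<rho> x \<le> \<rho> y"
    and "x \<in> einterval a b \<Longrightarrow> y \<in> einterval a b \<Longrightarrow> x \<le> y \<Longrightarrow> ennreal \<bar>\<rho> y - \<rho> x\<bar> =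
      (\<integral>\<^sup>+t\<in>{x..<y}. ennreal (if t \<in> einterval a b then deriv \<rho> t else 0) \<partial>lborel)"
proof -
  obtain D where D: "\<And>x. x \<in> einterval a b \<Longrightarrow> (\<rho> has_real_derivative D x) (at x)"
    "continuous_on (einterval a b) D"
    using \<rho> unfolding C1_differentiable_on_def has_real_derivative_iff_has_vector_derivative by blast
  have d: "deriv \<rho> x = D x" if "x \<in> einterval a b" for x
    using D(1)[OF that] by (rule DERIV_imp_deriv)
  have DERIV: "(\<rho> has_real_derivative (if x \<in> einterval a b then deriv \<rho> x else 0)) (at x)"
    if "x \<in> einterval a b" for x
    using D(1)[OF that] d[OF that] that by simp
  have "continuous_on (einterval a b) (deriv \<rho>)"
    using D(2) d by (simp cong: continuous_on_cong)
  then show meas: "(\<lambda>x. if x \<in> einterval a b then deriv \<rho> x else 0) \<in> borel_measurable borel"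
    by (intro borel_measurable_continuous_on_if) auto
  show mono: "\<rho> x \<le> \<rho> y" if xy: "x \<in> einterval a b" "y \<in> einterval a b" "x \<le> y" for x y
  proof (rule DERIV_nonneg_imp_nondecreasing[OF xy(3)])
    fix z assume "x \<le> z" "z \<le> y"
    then have "z \<in> einterval a b" using subsetD[OF einterval_Icc_subset[OF xy(1,2)], of z] by simp
    then show "\<exists>d. (\<rho> has_real_derivative d) (at z) \<and> 0 \<le> d"
      using D(1) d pos by metis
  qed
  show "ennreal \<bar>\<rho> y - \<rho> x\<bar> =
      (\<integral>\<^sup>+t\<in>{x..<y}. ennreal (if t \<in> einterval a b then deriv \<rho> t else 0) \<partial>lborel)"
    if xy: "x \<in> einterval a b" "y \<in> einterval a b" "x \<le> y"
  proof -
    note sub = subsetD[OF einterval_Icc_subset[OF xy(1,2)]]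
    have "(\<integral>\<^sup>+t\<in>{x..<y}. ennreal (if t \<in> einterval a b then deriv \<rho> t else 0) \<partial>lborel)
        = (\<integral>\<^sup>+t\<in>{x..y}. ennreal (if t \<in> einterval a b then deriv \<rho> t else 0) \<partial>lborel)"
      by (intro nn_integral_cong_AE eventually_mono[OF AE_lborel_singleton[of y]])
        (auto simp: indicator_def)
    also have "\<dots> = ennreal (\<rho> y - \<rho> x)"
    proof (rule nn_integral_FTC_Icc[OF meas _ _ xy(3)])
      fix z assume "z \<in> {x..y}"
      then have "z \<in> einterval a b" by (rule sub)
      then show "(\<rho> has_real_derivative (if z \<in> einterval a b then deriv \<rho> z else 0)) (at z)"
        "0 \<le> (if z \<in> einterval a b then deriv \<rho> z else 0)"
        using DERIV pos by simp_all
    qed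
    finally show ?thesis using mono[OF xy] by simp
  qed
qed

section \<open>Speed, scale and the normalised invariant measure\<close>

locale diffusion =
  fixes a b :: "real \<Rightarrow> real" and c0 :: real and x0 y0 :: ereal
  assumes a_cont: "continuous_on (einterval x0 y0) a"
    and b_cont: "continuous_on (einterval x0 y0) b"
    and a_pos: "\<And>x. x \<in> einterval x0 y0 \<Longrightarrow> 0 < a x"
    and c0: "c0 \<in> einterval x0 y0"
    and mass: "speed_mass a b c0 x0 y0 < \<infinity>"
begin

abbreviation "I \<equiv> einterval x0 y0"
abbreviation "s \<equiv> scale_deriv a b c0"
abbreviation "m \<equiv> speed_deriv a b c0"
abbreviation "\<mu> \<equiv> invariant_measure a b c0 x0 y0"
definition "Z = enn2real (speed_mass a b c0 x0 y0)"

lemma scale_pos: "0 < s x" by (simp add: scale_deriv_def)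

lemma speed_pos: "x \<in> I \<Longrightarrow> 0 < m x" using a_pos by (simp add: speed_deriv_def)

lemma scale_times_speed: "x \<in> I \<Longrightarrow> s x * m x * a x = 1"
  using a_pos[of x] by (simp add: scale_deriv_def speed_deriv_def exp_minus)

lemma speed_continuous: "continuous_on I m"
proof -
  have a_ne: "a x \<noteq> 0" if "x \<in> I" for x using a_pos[OF that] by simp
  then have ba: "continuous_on I (\<lambda>z. b z / a z)"
    by (intro continuous_on_divide a_cont b_cont) auto
  have "continuous_on I (\<lambda>x. LBINT z=ereal c0..ereal x. b z / a z)"
    by (intro continuous_at_imp_continuous_on ballI
        DERIV_isCont[OF interval_integral_has_real_derivative[OF ba c0]])
  then show ?thesis
    unfolding speed_deriv_def using a_ne by (intro continuous_intros a_cont) auto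
qed

lemma speed_measurable [measurable]: "m \<in> borel_measurable (restrict_space lborel I)"
  using borel_measurable_continuous_on_restrict[OF speed_continuous]
  by (simp cong: measurable_cong_sets add: sets_restrict_space)

text \<open>The speed density is positive on a compact interval of positive length around
  \<open>c0\<close>.\<close>

lemma mass_pos: "0 < Z"
proof -
  obtain p q where pq: "p < c0" "c0 < q" "p \<in> I" "q \<in> I"
    by (rule einterval_wider[OF c0 c0])
  have "speed_mass a b c0 x0 y0 \<noteq> 0"
  proof
    assume "speed_mass a b c0 x0 y0 = 0"
    then have "(\<integral>\<^sup>+x. ennreal (m x) \<partial>restrict_space lborel I) = 0"
      by (simp add: speed_mass_def nn_integral_restrict_space)
    then have "AE x in restrict_space lborel I. ennreal (m x) = 0"
      by (subst (asm) nn_integral_0_iff_AE) auto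
    then have "AE x in lborel. x \<in> I \<longrightarrow> ennreal (m x) = 0"
      by (subst (asm) AE_restrict_space_iff) auto
    then have "AE x in lborel. x \<notin> {p..q}"
    proof eventually_elim
      case (elim x)
      then show ?case
        using speed_pos[of x] subsetD[OF einterval_Icc_subset[OF pq(3,4)], of x] by (auto simp: ennreal_eq_0_iff)
    qed
    then have "emeasure lborel {p..q} = 0"
      by (subst (asm) AE_iff_measurable[of "{p..q}"]) auto
    then show False using pq by simp
  qed
  then show ?thesis using mass by (simp add: Z_def enn2real_positive_iff zero_less_iff_neq_zero)
qed

text \<open>Replaces division in \<open>ennreal\<close> by division of reals, so that results about
  real densities apply to \<mu>.\<close>

lemma invariant_measure_eq:
  "\<mu> = density (restrict_space lborel I) (\<lambda>x. ennreal (m x / Z))"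
proof -
  have "speed_mass a b c0 x0 y0 = ennreal Z" using mass by (simp add: Z_def)
  then show ?thesis
    unfolding invariant_measure_def using mass_pos speed_pos
    by (intro density_cong) (auto simp: space_restrict_space divide_ennreal less_imp_le intro!: AE_I2)
qed

lemma sets_invariant: "sets \<mu> = sets (restrict_space borel I)"
  by (simp add: invariant_measure_def sets_restrict_space)

lemma space_invariant: "space \<mu> = I"
  by (simp add: invariant_measure_def space_restrict_space)

lemma measurable_invariant: "measurable \<mu> N = measurable (restrict_space lborel I) N"
  unfolding invariant_measure_def by (rule measurable_cong_sets) simp_all

lemma continuous_on_measurable_invariant: "continuous_on I f \<Longrightarrow> f \<in> borel_measurable \<mu>"
  unfolding measurable_cong_sets[OF sets_invariant refl] by (rule borel_measurable_continuous_on_restrict)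

lemma borel_measurable_invariant: "f \<in> borel_measurable borel \<Longrightarrow> f \<in> borel_measurable \<mu>"
  unfolding measurable_cong_sets[OF sets_invariant refl] by (rule measurable_restrict_space1)

lemma nn_integral_invariant:
  assumes "f \<in> borel_measurable \<mu>"
  shows "(\<integral>\<^sup>+x. f x \<partial>\<mu>) = (\<integral>\<^sup>+x\<in>I. ennreal (m x / Z) * f x \<partial>lborel)"
  unfolding invariant_measure_eq using assms measurable_invariant
  by (subst nn_integral_density) (auto simp: nn_integral_restrict_space)

lemma prob_space_invariant: "prob_space \<mu>"
proof (rule prob_spaceI)
  have "emeasure \<mu> (space \<mu>) = (\<integral>\<^sup>+x. 1 \<partial>\<mu>)" by simp
  also have "\<dots> = (\<integral>\<^sup>+x\<in>I. ennreal (m x / Z) * 1 \<partial>lborel)"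
    by (rule nn_integral_invariant) simp
  also have "\<dots> = (\<integral>\<^sup>+x. ennreal (m x) / ennreal Z * indicator I x \<partial>lborel)"
    using mass_pos speed_pos
    by (intro nn_integral_cong) (auto simp: divide_ennreal less_imp_le indicator_def)
  also have "\<dots> = (\<integral>\<^sup>+x. ennreal (m x) / ennreal Z \<partial>restrict_space lborel I)"
    by (simp add: nn_integral_restrict_space)
  also have "\<dots> = (\<integral>\<^sup>+x. ennreal (m x) \<partial>restrict_space lborel I) / ennreal Z"
    by (rule nn_integral_divide) measurable
  also have "(\<integral>\<^sup>+x. ennreal (m x) \<partial>restrict_space lborel I) = ennreal Z"
    using mass by (simp add: Z_def speed_mass_def nn_integral_restrict_space)
  also have "ennreal Z / ennreal Z = 1" using mass_pos by (simp add: divide_ennreal)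
  finally show "emeasure \<mu> (space \<mu>) = 1" .
qed

lemma AE_invariant: "(AE x in lborel. x \<in> I \<longrightarrow> P x) \<Longrightarrow> AE x in \<mu>. P x"
  unfolding invariant_measure_eq
  by (subst AE_density, measurable, subst AE_restrict_space_iff) (auto elim: eventually_mono)

text \<open>Full support of \<mu>; it is what makes the constant C strictly positive.\<close>

lemma emeasure_invariant_pos:
  assumes "p < q" "p \<in> I" "q \<in> I"
  shows "{p..q} \<in> sets \<mu>" "0 < emeasure \<mu> {p..q}"
proof -
  note sub = einterval_Icc_subset[OF assms(2,3)]
  then show S: "{p..q} \<in> sets \<mu>"
    unfolding sets_invariant by (subst sets_restrict_space_iff) auto
  have "emeasure \<mu> {p..q} \<noteq> 0"
  proof
    assume "emeasure \<mu> {p..q} = 0"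
    then have "AE x in \<mu>. x \<notin> {p..q}"
      using S by (intro AE_not_in) auto
    then have "AE x in lborel. x \<in> I \<longrightarrow> 0 < ennreal (m x / Z) \<longrightarrow> x \<notin> {p..q}"
      unfolding invariant_measure_eq
      by (subst (asm) AE_density, measurable, subst (asm) AE_restrict_space_iff) auto
    then have "AE x in lborel. x \<notin> {p..q}"
      
    proof eventually_elim
      case (elim x)
      then show ?case
        using speed_pos[of x] mass_pos subsetD[OF sub, of x] by auto
    qed
    then have "emeasure lborel {p..q} = 0"
      by (subst (asm) AE_iff_measurable[of "{p..q}"]) auto
    then show False using assms by simp
  qed
  then show "0 < emeasure \<mu> {p..q}" by (simp add: zero_less_iff_neq_zero)
qed

text \<open>Translates the oriented integral in \<open>C_const\<close> into an integral over \<mu>,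
  where the covariance formula lives. The factor Z undoes the normalisation of \<mu>.\<close>

lemma tail_integral_eq:
  assumes \<rho>: "\<rho> \<in> borel_measurable \<mu>" and t: "t \<in> I"
  shows "(LBINT z=ereal t..y0. (\<rho> z - c) * m z) = Z * (LINT z:{t<..}|\<mu>. \<rho> z - c)"
proof -
  have ty: "ereal t \<le> y0" "x0 < ereal t" using t by (auto simp: einterval_iff)
  have tI: "indicat_real (einterval t y0) z = indicat_real I z * indicat_real {t<..} z" for z
    using ty by (auto simp: indicator_def einterval_iff intro: less_trans)
  note \<rho>[measurable]
  have "{t<..} \<in> sets borel" by simp
  then have mf: "(\<lambda>z. indicat_real {t<..} z *\<^sub>R (\<rho> z - c)) \<in> borel_measurable \<mu>"
    using borel_measurable_invariant[of "indicat_real {t<..}"] by simp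
  have "(LINT z:{t<..}|\<mu>. \<rho> z - c) = (LINT z|\<mu>. indicat_real {t<..} z *\<^sub>R (\<rho> z - c))"
    by (simp add: set_lebesgue_integral_def)
  also have "\<dots> = (LINT z|restrict_space lborel I. (m z / Z) *\<^sub>R (indicat_real {t<..} z *\<^sub>R (\<rho> z - c)))"
    unfolding invariant_measure_eq
  proof (rule integral_density)
    show "(\<lambda>z. indicat_real {t<..} z *\<^sub>R (\<rho> z - c)) \<in> borel_measurable (restrict_space lborel I)"
      using mf unfolding measurable_invariant .
    show "AE z in restrict_space lborel I. 0 \<le> m z / Z"
      using speed_pos mass_pos by (intro AE_I2) (auto simp: space_restrict_space less_imp_le)
  qed measurable
  also have "\<dots> = (LBINT z. indicat_real I z *\<^sub>R ((m z / Z) *\<^sub>R (indicat_real {t<..} z *\<^sub>R (\<rho> z - c))))"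
    by (rule integral_restrict_space) auto
  also have "\<dots> = (LBINT z. (1 / Z) * (indicat_real (einterval t y0) z *\<^sub>R ((\<rho> z - c) * m z)))"
    by (intro Bochner_Integration.integral_cong) (auto simp: tI)
  also have "\<dots> = (1 / Z) * (LBINT z=ereal t..y0. (\<rho> z - c) * m z)"
    using ty by (simp add: interval_lebesgue_integral_def set_lebesgue_integral_def)
  finally show ?thesis using mass_pos by simp
qed

section \<open>The transport-information inequality\<close>

lemma transport_information:
  assumes \<rho>: "\<rho> C1_differentiable_on I" "square_integrable \<mu> \<rho>"
    and pos: "\<And>x. x \<in> I \<Longrightarrow> 0 < deriv \<rho> x"
    and C_fin: "C_const a b c0 x0 y0 \<rho> < \<infinity>"
    and sigma_fin: "sigma_const a x0 y0 \<rho> < \<infinity>"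
  shows "W1I a \<mu> (metric_of \<rho>) (real_of_ereal (sigma_const a x0 y0 \<rho>) * real_of_ereal (C_const a b c0 x0 y0 \<rho>))"
proof -
  interpret prob_space \<mu> by (rule prob_space_invariant)
  interpret PP: pair_prob_space \<mu> \<mu> ..
  have \<rho>m: "\<rho> \<in> borel_measurable \<mu>" and \<rho>2: "integrable \<mu> (\<lambda>x. (\<rho> x)\<^sup>2)"
    using \<rho>(2) by (auto simp: square_integrable_def)
  have \<rho>i: "integrable \<mu> \<rho>" by (rule square_integrable_imp_integrable[OF \<rho>m \<rho>2])
  have pos': "\<forall>x\<in>I. 0 \<le> deriv \<rho> x" using pos by (simp add: less_imp_le)
  note FTC = C1_increment_eq_nn_integral[OF \<rho>(1) pos']
  define C where "C = real_of_ereal (C_const a b c0 x0 y0 \<rho>)"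
  define \<sigma> where "\<sigma> = real_of_ereal (sigma_const a x0 y0 \<rho>)"
  define B where "B t = (LINT z:{t<..}|\<mu>. \<rho> z - (LINT w|\<mu>. \<rho> w))" for t
  define K where "K t = (\<integral>\<^sup>+p. (if fst p \<le> t \<and> t \<le> snd p then ennreal \<bar>\<rho> (snd p) - \<rho> (fst p)\<bar> else 0)
      \<partial>(\<mu> \<Otimes>\<^sub>M \<mu>))" for t
  have KB: "K t = ennreal (B t)" for t
    unfolding K_def B_def
    by (rule nn_integral_pair_increment[OF prob_space_invariant sets_invariant \<rho>i FTC(2)])
      (auto intro!: AE_invariant intro: eventually_mono[OF AE_lborel_singleton[of t]])
  have C_upper: "ereal (s t / deriv \<rho> t * (Z * B t)) \<le> C_const a b c0 x0 y0 \<rho>" if "t \<in> I" for t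
    unfolding C_const_def tail_integral_eq[OF \<rho>m that, symmetric] B_def
    using that by (intro SUP_upper2[of t]) (simp_all add: B_def tail_integral_eq[OF \<rho>m that])
  \<comment> \<open>The hypothesis excludes plus infinity, the value at \<open>c0\<close> excludes
    minus infinity. Only then does \<open>real_of_ereal\<close> return the supremum itself instead
    of its default 0.\<close>
  have "\<bar>C_const a b c0 x0 y0 \<rho>\<bar> \<noteq> \<infinity>"
    using C_fin C_upper[OF c0] by auto
  then have C_eq: "C_const a b c0 x0 y0 \<rho> = ereal C" by (simp add: C_def ereal_real)
  have C: "s t / deriv \<rho> t * (Z * B t) \<le> C" if "t \<in> I" for t
    using C_upper[OF that] by (simp add: C_eq)
  have sigma_upper: "ereal (sqrt (a t) * deriv \<rho> t) \<le> sigma_const a x0 y0 \<rho>" if "t \<in> I" for t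
    unfolding sigma_const_def using that by (rule SUP_upper)
  have "\<bar>sigma_const a x0 y0 \<rho>\<bar> \<noteq> \<infinity>"
    using sigma_fin sigma_upper[OF c0] by auto
  then have sigma_eq: "sigma_const a x0 y0 \<rho> = ereal \<sigma>" by (simp add: \<sigma>_def ereal_real)
  have \<sigma>: "sqrt (a t) * deriv \<rho> t \<le> \<sigma>" if "t \<in> I" for t
    using sigma_upper[OF that] by (simp add: sigma_eq)
  have "0 < \<sigma>" using \<sigma>[OF c0] a_pos[OF c0] pos[OF c0] by (smt (verit) mult_pos_pos real_sqrt_gt_zero)
  \<comment> \<open>Needed for C > 0: in \<open>ennreal\<close>, 0 times infinity is 0, so with a
    vanishing constant the case of infinite information would give no bound.\<close>
  have "0 < B c0"
  proof -
    obtain p q where pq: "p < c0" "c0 < q" "p \<in> I" "q \<in> I"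
      by (rule einterval_wider[OF c0 c0])
    \<comment> \<open>A point strictly between \<open>c0\<close> and q. On the rectangle {p..c0} x
      {r..q}, which has positive mass, the increment of \<rho> is at least \<rho>(r) - \<rho>(c0) >
      0.\<close>
    define r where "r = (c0 + q) / 2"
    have r: "c0 < r" "r < q" using pq by (auto simp: r_def)
    then have rI: "r \<in> I" using einterval_Icc_subset[OF c0 pq(4)] by auto
    have sub: "{p..q} \<subseteq> I" by (rule einterval_Icc_subset[OF pq(3,4)])
    have "\<rho> c0 < \<rho> r"
    proof (rule DERIV_pos_imp_increasing[OF r(1)])
      fix x assume "c0 \<le> x" "x \<le> r"
      then have x: "x \<in> I" using einterval_Icc_subset[OF c0 rI] by auto
      then have "\<rho> differentiable at x"
        using \<rho>(1) unfolding C1_differentiable_on_eq by blast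
      with pos[OF x] show "\<exists>y. (\<rho> has_real_derivative y) (at x) \<and> 0 < y"
        using DERIV_deriv_iff_real_differentiable by blast
    qed
    note A1 = emeasure_invariant_pos[OF pq(1,3) c0] and A2 = emeasure_invariant_pos[OF r(2) rI pq(4)]
    have "0 < ennreal (\<rho> r - \<rho> c0) * (emeasure \<mu> {p..c0} * emeasure \<mu> {r..q})"
      using A1(2) A2(2) \<open>\<rho> c0 < \<rho> r\<close> by (simp add: zero_less_iff_neq_zero)
    also have "\<dots> = ennreal (\<rho> r - \<rho> c0) * emeasure (\<mu> \<Otimes>\<^sub>M \<mu>) ({p..c0} \<times> {r..q})"
      using A1(1) A2(1) by (simp add: emeasure_pair_measure_Times)
    also have "\<dots> = (\<integral>\<^sup>+z. ennreal (\<rho> r - \<rho> c0) * indicator ({p..c0} \<times> {r..q}) z \<partial>(\<mu> \<Otimes>\<^sub>M \<mu>))"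
      using A1(1) A2(1) by (intro nn_integral_cmult_indicator[symmetric]) auto
    also have "\<dots> \<le> K c0"
      unfolding K_def
    proof (rule nn_integral_mono)
      fix z
      show "ennreal (\<rho> r - \<rho> c0) * indicator ({p..c0} \<times> {r..q}) z
          \<le> (if fst z \<le> c0 \<and> c0 \<le> snd z then ennreal \<bar>\<rho> (snd z) - \<rho> (fst z)\<bar> else 0)"
      proof (cases "z \<in> {p..c0} \<times> {r..q}")
        case True
        then have z: "p \<le> fst z" "fst z \<le> c0" "r \<le> snd z" "snd z \<le> q" by auto
        then have zI: "fst z \<in> I" "snd z \<in> I" using sub r pq by (auto simp: subset_iff)
        have "\<rho> (fst z) \<le> \<rho> c0" "\<rho> r \<le> \<rho> (snd z)"
          using FTC(2)[OF zI(1) c0] FTC(2)[OF rI zI(2)] z by auto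
        then show ?thesis using z r True by (auto intro!: ennreal_leI)
      qed simp
    qed
    finally show ?thesis unfolding KB by simp
  qed
  then have "0 < C"
    using C[OF c0] scale_pos[of c0] pos[OF c0] mass_pos by (smt (verit) divide_pos_pos mult_pos_pos)
  have c: "0 < 4 * (\<sigma> * C)\<^sup>2" using \<open>0 < C\<close> \<open>0 < \<sigma>\<close> by simp
  \<comment> \<open>The bound defining C is multiplied by m a / Z; on the left s m a = 1 cancels,
    and on the right m / Z is the density of \<mu>.\<close>
  have B_le: "B t \<le> C * deriv \<rho> t * a t * (m t / Z)" if "t \<in> I" for t
  proof -
    have "s t * (Z * B t) \<le> C * deriv \<rho> t"
      using C[OF that] pos[OF that] by (simp add: field_simps)
    then have "(s t * (Z * B t)) * (m t * a t / Z) \<le> C * deriv \<rho> t * (m t * a t / Z)"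
      using speed_pos[OF that] a_pos[OF that] mass_pos by (intro mult_right_mono) auto
    also have "(s t * (Z * B t)) * (m t * a t / Z) = (s t * m t * a t) * B t"
      using mass_pos by simp
    finally show ?thesis using scale_times_speed[OF that] by (simp add: mult_ac)
  qed
  have "(wasserstein1 (metric_of \<rho>) \<nu> \<mu>)\<^sup>2 \<le> ennreal (4 * (\<sigma> * C)\<^sup>2) * fisher_information a \<nu> \<mu>"
    if \<nu>: "prob_space \<nu>" for \<nu>
  proof (cases "\<exists>f. sqrt_density_in_domain a \<mu> \<nu> f")
    case False
    then have "fisher_information a \<nu> \<mu> = \<infinity>" by (simp add: fisher_information_def)
    then show ?thesis using c by (simp add: ennreal_mult_top)
  next
    case True
    \<comment> \<open>The same choice as in \<open>fisher_information\<close>, so that the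
      information is literally the Dirichlet form of this h.\<close>
    define f where "f = (SOME f. sqrt_density_in_domain a \<mu> \<nu> f)"
    define h where "h = (\<lambda>x. sqrt (f x))"
    have f: "sqrt_density_in_domain a \<mu> \<nu> f" unfolding f_def using someI_ex[OF True] .
    have fisher: "fisher_information a \<nu> \<mu> = dirichlet_form a \<mu> h"
      using True by (simp add: fisher_information_def f_def h_def)
    have f': "f \<in> borel_measurable \<mu>" "\<And>x. x \<in> I \<Longrightarrow> 0 \<le> f x" "\<nu> = density \<mu> (\<lambda>x. ennreal (f x))"
      and hd: "h \<in> dirichlet_domain a \<mu>"
      using f unfolding sqrt_density_in_domain_def h_def space_invariant by auto
    have h: "locally_abs_cont_on I h"
      using hd by (simp add: dirichlet_domain_def space_invariant)
    have \<nu>_eq: "\<nu> = density \<mu> (\<lambda>x. ennreal ((h x)\<^sup>2))"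
      unfolding f'(3) using f'(1,2)
      by (intro density_cong) (auto simp: h_def space_invariant intro!: AE_I2)
    obtain g where g: "g \<in> borel_measurable borel"
      "AE x in lborel. x \<in> I \<longrightarrow> (h has_real_derivative g x) (at x)"
      by (rule locally_abs_cont_on_deriv[OF h])
    have [measurable]: "h \<in> borel_measurable \<mu>" "g \<in> borel_measurable \<mu>" "a \<in> borel_measurable \<mu>"
      "\<rho> \<in> borel_measurable \<mu>"
      by (intro continuous_on_measurable_invariant locally_abs_cont_on_imp_continuous_on[OF h]
          borel_measurable_invariant g(1) a_cont \<rho>m)+
    let ?r = "\<lambda>x. if x \<in> I then deriv \<rho> x else 0"
    have r[measurable]: "?r \<in> borel_measurable \<mu>"
      by (rule borel_measurable_invariant[OF FTC(1)])
    let ?J = "\<integral>\<^sup>+t. ennreal \<bar>h t\<bar> * ennreal (sqrt (a t) * \<bar>g t\<bar>) \<partial>\<mu>"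
    have "wasserstein1 (metric_of \<rho>) \<nu> \<mu> \<le> (\<integral>\<^sup>+t\<in>I. ennreal (2 * \<bar>h t\<bar> * \<bar>g t\<bar>) * K t \<partial>lborel)"
      unfolding \<nu>_eq K_def
      by (rule wasserstein1_density_le[OF prob_space_invariant sets_invariant \<nu>[unfolded \<nu>_eq]
            \<rho>m[unfolded measurable_cong_sets[OF sets_invariant refl]] FTC(1,3) h g])
    \<comment> \<open>The bound \<open>B_le\<close> for K brings in the density m / Z, which turns
      the Lebesgue integral into one over \<mu>.\<close>
    also have "\<dots> \<le> (\<integral>\<^sup>+t\<in>I. ennreal (m t / Z) * ennreal (2 * \<bar>h t\<bar> * \<bar>g t\<bar> * (C * ?r t * a t)) \<partial>lborel)"
    proof (rule nn_integral_mono)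
      fix t
      have "ennreal (2 * \<bar>h t\<bar> * \<bar>g t\<bar>) * K t
          \<le> ennreal (m t / Z) * ennreal (2 * \<bar>h t\<bar> * \<bar>g t\<bar> * (C * ?r t * a t))" if t: "t \<in> I"
      proof -
        have "ennreal (2 * \<bar>h t\<bar> * \<bar>g t\<bar>) * K t
            \<le> ennreal (2 * \<bar>h t\<bar> * \<bar>g t\<bar>) * ennreal (C * deriv \<rho> t * a t * (m t / Z))"
          unfolding KB by (intro mult_left_mono ennreal_leI B_le[OF t]) simp
        also have "\<dots> = ennreal ((2 * \<bar>h t\<bar> * \<bar>g t\<bar>) * (C * deriv \<rho> t * a t * (m t / Z)))"
          by (rule ennreal_mult'[symmetric]) simp
        also have "(2 * \<bar>h t\<bar> * \<bar>g t\<bar>) * (C * deriv \<rho> t * a t * (m t / Z))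
            = (m t / Z) * (2 * \<bar>h t\<bar> * \<bar>g t\<bar> * (C * ?r t * a t))"
          using t by simp
        also have "ennreal \<dots> = ennreal (m t / Z) * ennreal (2 * \<bar>h t\<bar> * \<bar>g t\<bar> * (C * ?r t * a t))"
          using speed_pos[OF t] mass_pos by (intro ennreal_mult') simp
        finally show ?thesis .
      qed
      then show "ennreal (2 * \<bar>h t\<bar> * \<bar>g t\<bar>) * K t * indicator I t
          \<le> ennreal (m t / Z) * ennreal (2 * \<bar>h t\<bar> * \<bar>g t\<bar> * (C * ?r t * a t)) * indicator I t"
        by (auto simp: indicator_def)
    qed
    also have "\<dots> = (\<integral>\<^sup>+t. ennreal (2 * \<bar>h t\<bar> * \<bar>g t\<bar> * (C * ?r t * a t)) \<partial>\<mu>)"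
      by (rule nn_integral_invariant[symmetric]) measurable
    also have "\<dots> \<le> (\<integral>\<^sup>+t. ennreal (2 * (\<sigma> * C)) * (ennreal \<bar>h t\<bar> * ennreal (sqrt (a t) * \<bar>g t\<bar>)) \<partial>\<mu>)"
    proof (rule nn_integral_mono)
      fix t assume "t \<in> space \<mu>"
      then have t: "t \<in> I" by (simp add: space_invariant)
      \<comment> \<open>One factor sqrt (a t) joins the derivative of \<rho> and is bounded by
        \<sigma>; the other stays with |g t| for Cauchy-Schwarz.\<close>
      have "2 * \<bar>h t\<bar> * \<bar>g t\<bar> * (C * ?r t * a t)
          = 2 * \<bar>h t\<bar> * \<bar>g t\<bar> * C * sqrt (a t) * (sqrt (a t) * deriv \<rho> t)"
      proof -
        have "a t = sqrt (a t) * sqrt (a t)" using a_pos[OF t] by simp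
        then show ?thesis using t by simp
      qed
      also have "\<dots> \<le> 2 * \<bar>h t\<bar> * \<bar>g t\<bar> * C * sqrt (a t) * \<sigma>"
        using \<open>0 < C\<close> a_pos[OF t] by (intro mult_left_mono \<sigma>[OF t]) simp
      also have "\<dots> = 2 * (\<sigma> * C) * (\<bar>h t\<bar> * (sqrt (a t) * \<bar>g t\<bar>))" by simp
      finally have "ennreal (2 * \<bar>h t\<bar> * \<bar>g t\<bar> * (C * ?r t * a t))
          \<le> ennreal (2 * (\<sigma> * C) * (\<bar>h t\<bar> * (sqrt (a t) * \<bar>g t\<bar>)))" by (rule ennreal_leI)
      also have "\<dots> = ennreal (2 * (\<sigma> * C)) * (ennreal \<bar>h t\<bar> * ennreal (sqrt (a t) * \<bar>g t\<bar>))"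
        using \<open>0 < C\<close> \<open>0 < \<sigma>\<close> by (simp add: ennreal_mult')
      finally show "ennreal (2 * \<bar>h t\<bar> * \<bar>g t\<bar> * (C * ?r t * a t)) \<le> \<dots>" .
    qed
    also have "\<dots> = ennreal (2 * (\<sigma> * C)) * ?J"
      by (rule nn_integral_cmult) measurable
    finally have "(wasserstein1 (metric_of \<rho>) \<nu> \<mu>)\<^sup>2 \<le> (ennreal (2 * (\<sigma> * C)) * ?J)\<^sup>2"
      by (rule power_mono) simp
    also have "\<dots> = ennreal (4 * (\<sigma> * C)\<^sup>2) * ?J\<^sup>2"
      using \<open>0 < C\<close> \<open>0 < \<sigma>\<close> by (simp add: power_mult_distrib ennreal_power)
    also have "?J\<^sup>2 \<le> (\<integral>\<^sup>+t. (ennreal \<bar>h t\<bar>)\<^sup>2 \<partial>\<mu>) * (\<integral>\<^sup>+t. (ennreal (sqrt (a t) * \<bar>g t\<bar>))\<^sup>2 \<partial>\<mu>)"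
      by (rule Cauchy_Schwarz_nn_integral) measurable
    \<comment> \<open>The integral of h^2 is the total mass of the probability measure
      \<nu>.\<close>
    also have "(\<integral>\<^sup>+t. (ennreal \<bar>h t\<bar>)\<^sup>2 \<partial>\<mu>) = 1"
    proof -
      have "(\<integral>\<^sup>+t. (ennreal \<bar>h t\<bar>)\<^sup>2 \<partial>\<mu>) = emeasure \<nu> (space \<nu>)"
        unfolding \<nu>_eq by (subst emeasure_density)
          (auto simp: ennreal_power indicator_def intro!: nn_integral_cong)
      then show ?thesis using prob_space.emeasure_space_1[OF \<nu>] by simp
    qed
    also have "(\<integral>\<^sup>+t. (ennreal (sqrt (a t) * \<bar>g t\<bar>))\<^sup>2 \<partial>\<mu>) = dirichlet_form a \<mu> h"
      unfolding dirichlet_form_def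
    proof (rule nn_integral_cong_AE)
      have "AE t in \<mu>. (h has_real_derivative g t) (at t)" by (rule AE_invariant[OF g(2)])
      then show "AE t in \<mu>. (ennreal (sqrt (a t) * \<bar>g t\<bar>))\<^sup>2 = ennreal (a t * (deriv h t)\<^sup>2)"
        using AE_space
      proof eventually_elim
        case (elim t)
        then have "deriv h t = g t" "0 < a t" using a_pos by (auto simp: DERIV_imp_deriv space_invariant)
        then show ?case by (simp add: ennreal_power power_mult_distrib)
      qed
    qed
    finally show ?thesis by (simp add: fisher mult_left_mono)
  qed
  then show ?thesis by (simp add: W1I_def C_def \<sigma>_def)
qed

section \<open>The special case of the function \<open>rho_a\<close>\<close>

lemma rho_a_has_real_derivative:
  assumes "x \<in> I"
  shows "(rho_a a c0 has_real_derivative 1 / sqrt (a x)) (at x)"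
proof -
  have "continuous_on I (\<lambda>z. 1 / sqrt (a z))"
    by (intro continuous_intros a_cont) (auto dest: a_pos)
  then show ?thesis
    unfolding rho_a_def using c0 assms by (rule interval_integral_has_real_derivative)
qed

lemma deriv_rho_a: "x \<in> I \<Longrightarrow> deriv (rho_a a c0) x = 1 / sqrt (a x)"
  by (rule DERIV_imp_deriv[OF rho_a_has_real_derivative])

lemma rho_a_C1: "rho_a a c0 C1_differentiable_on I"
  unfolding C1_differentiable_on_def has_real_derivative_iff_has_vector_derivative[symmetric]
proof (intro exI[of _ "\<lambda>x. 1 / sqrt (a x)"] conjI ballI rho_a_has_real_derivative)
  show "continuous_on I (\<lambda>z. 1 / sqrt (a z))"
    by (intro continuous_intros a_cont) (auto dest: a_pos)
qed

text \<open>The derivative of \<open>rho_a\<close> is 1 / sqrt a, so the supremum is over the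
  constant 1; the point \<open>c0\<close> keeps its index set nonempty.\<close>

lemma sigma_rho_a: "sigma_const a x0 y0 (rho_a a c0) = 1"
proof -
  have "sqrt (a x) * deriv (rho_a a c0) x = 1" if "x \<in> I" for x
    using a_pos[OF that] by (simp add: deriv_rho_a[OF that])
  then have "sigma_const a x0 y0 (rho_a a c0) = (SUP x\<in>I. 1)"
    unfolding sigma_const_def by (intro SUP_cong) (auto simp: one_ereal_def)
  also have "\<dots> = 1" using c0 by (intro cSUP_const) auto
  finally show ?thesis .
qed

end

theorem corollary4p5:
  fixes a b :: "real \<Rightarrow> real" and c0 :: real and x0 y0 :: ereal
  assumes "continuous_on (einterval x0 y0) a"
    and "continuous_on (einterval x0 y0) b"
    and "\<forall>x\<in>einterval x0 y0. 0 < a x"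
    and "c0 \<in> einterval x0 y0"
    and "speed_mass a b c0 x0 y0 < \<infinity>"
    and "(\<integral>\<^sup>+ x\<in>einterval (ereal c0) y0. ennreal (scale_deriv a b c0 x *
            (LBINT z=ereal c0..ereal x. speed_deriv a b c0 z)) \<partial>lborel) = \<infinity>"
    and "(\<integral>\<^sup>+ x\<in>einterval x0 (ereal c0). ennreal (scale_deriv a b c0 x *
            (LBINT z=ereal x..ereal c0. speed_deriv a b c0 z)) \<partial>lborel) = \<infinity>"
  shows "(\<forall>\<rho> :: real \<Rightarrow> real.
            \<rho> C1_differentiable_on (einterval x0 y0) \<and>
            square_integrable (invariant_measure a b c0 x0 y0) \<rho> \<and>
            (\<forall>x\<in>einterval x0 y0. 0 < deriv \<rho> x) \<and>
            C_const a b c0 x0 y0 \<rho> < \<infinity> \<and>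
            sigma_const a x0 y0 \<rho> < \<infinity>
            \<longrightarrow> W1I a (invariant_measure a b c0 x0 y0) (metric_of \<rho>)
                  (real_of_ereal (sigma_const a x0 y0 \<rho>) *
                   real_of_ereal (C_const a b c0 x0 y0 \<rho>)))
       \<and> (square_integrable (invariant_measure a b c0 x0 y0) (rho_a a c0) \<and>
            C_const a b c0 x0 y0 (rho_a a c0) < \<infinity>
            \<longrightarrow> W1I a (invariant_measure a b c0 x0 y0) (metric_of (rho_a a c0))
                  (real_of_ereal (C_const a b c0 x0 y0 (rho_a a c0))))"
proof -
  interpret diffusion a b c0 x0 y0
    using assms by unfold_locales auto
  have "W1I a \<mu> (metric_of (rho_a a c0)) (real_of_ereal (C_const a b c0 x0 y0 (rho_a a c0)))"
    if "square_integrable \<mu> (rho_a a c0)" "C_const a b c0 x0 y0 (rho_a a c0) < \<infinity>"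
    using transport_information[OF rho_a_C1 that(1) _ that(2)] a_pos
    by (simp add: sigma_rho_a deriv_rho_a)
  then show ?thesis using transport_information by blast
qed

end
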